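(* In the setting described in the context (in particular $w$ and the $\varepsilon_k$ Gaussian), let $\{u_k^\circ\}_{k=0}^{N-1}$ be the optimal updates of Problem $\mathrm{OLL}_\gamma^N$ (with $\gamma>0$) and let $\{u_k^\dagger\}_{k=0}^{N-1}$ be the updates of the Kalman-filter estimates, as defined in the context. Then $$\mathbb{E}\Big\{\sum_{k=0}^{N-1}(u_k^\circ)'(u_k^\circ)\Big\}\le\mathbb{E}\Big\{\sum_{k=0}^{N-1}(u_k^\dagger)'(u_k^\dagger)\Big\}.$$
   Context: A prime denotes transpose, $I$ is the $d\times d$ identity matrix, $N\ge1$ is an integer and $\gamma>0$. Data model: $w\in\mathbb{R}^d$ is a random vector, $x_k\in\mathbb{R}^d$ and $\varepsilon_k\in\mathbb{R}$ ($k=0,1,\dots$) are random inputs and noises; the random variables $w,\{x_k\},\{\varepsilon_k\}$ are mutually independent and have mean $0$; $w$ has covariance matrix $\Sigma_w$, the $\varepsilon_k$ have the same variance $\sigma_\varepsilon^2$, each $x_k$ has finite covariance matrix $\mathbb{E}\{x_kx_k'\}$; $w$ and the $\varepsilon_k$ are Gaussian. The outputs are $y_k=w'x_k+\varepsilon_k$. Put $Q_k:=x_kx_k'$. Learning machine: $\hat w_0:=0$, $\hat w_{k+1}=\hat w_k+u_k$, where the update $u_k\in\mathbb{R}^d$ is a function of the information vector $I_k:=\{(x_j,y_j),\ j=0,\dots,k;\ u_j,\ j=0,\dots,k-1\}$ ($I_0:=\{(x_0,y_0)\}$). The error is $e_k:=\hat w_k-w$, so $e_0=-w$ and $e_{k+1}=e_k+u_k$;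 with $\tilde y_k:=\hat w_k'x_k-y_k$, the vector $\tilde I_k:=\{(x_j,\tilde y_j),\ j=0,\dots,k;\ u_j,\ j=0,\dots,k-1\}$ is in one-to-one correspondence with $I_k$. Optimal updates: Problem $\mathrm{OLL}_\gamma^N$ is the minimization of $\mathbb{E}\{\sum_{k=0}^{N-1}[e_k'Q_ke_k+\gamma u_k'u_k]+e_N'Q_Ne_N\}$ over such updating functions. Its optimal updates are $u_k^\circ=L_k\mathbb{E}\{e_k^\circ|\tilde I_k\}$, with $e_0^\circ=-w$, $e_{k+1}^\circ=e_k^\circ+u_k^\circ$, $L_k:=-(\overline K_{k+1}+\gamma I)^{-1}\overline K_{k+1}$, $\overline K_N=\mathbb{E}\{Q_N\}$, $\overline K_k=\overline K_{k+1}-\overline K_{k+1}(\overline K_{k+1}+\gamma I)^{-1}\overline K_{k+1}+\mathbb{E}\{Q_k\}$. Kalman updates (the limit $\gamma\to0$): $u_k^\dagger:=-\mathbb{E}\{e_k^\dagger|\tilde I_k\}$, with $e_0^\dagger=-w$, $e_{k+1}^\dagger=e_k^\dagger+u_k^\dagger$. Equivalently, these are the updates for which, starting from the estimate $0$ at time $0$, the estimate at time $k+1$ is $\mathbb{E}\{w|I_k\}$. *)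

theory Defs
  imports "HOL-Probability.Probability"
begin

text \<open>
  A constant is admitted as a degenerate normal variable, so that singular covariance matrices
  and zero noise variance are not excluded.
\<close>

definition gaussian_rv :: "'a measure \<Rightarrow> ('a \<Rightarrow> real) \<Rightarrow> bool" where
  "gaussian_rv M X \<longleftrightarrow> X \<in> borel_measurable M \<and>
     ((\<exists>c. AE \<omega> in M. X \<omega> = c) \<or>
      (\<exists>\<mu> \<sigma>. \<sigma> > 0 \<and> distributed M lborel X (\<lambda>t. ennreal (normal_density \<mu> \<sigma> t))))"

definition gaussian_vec :: "'a measure \<Rightarrow> ('a \<Rightarrow> real ^ 'd) \<Rightarrow> bool" where
  "gaussian_vec M X \<longleftrightarrow> (\<forall>a. gaussian_rv M (\<lambda>\<omega>. a \<bullet> X \<omega>))"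

definition outer :: "real ^ 'd \<Rightarrow> real ^ 'd ^ 'd" where
  "outer v = (\<chi> i j. v $ i * v $ j)"

definition vec_cond_exp :: "'a measure \<Rightarrow> 'a measure \<Rightarrow> ('a \<Rightarrow> real ^ 'd) \<Rightarrow> 'a \<Rightarrow> real ^ 'd" where
  "vec_cond_exp M F f \<omega> = (\<chi> i. real_cond_exp M F (\<lambda>\<omega>. f \<omega> $ i) \<omega>)"

datatype source = Weight | Input nat | Noise nat

locale learning_model = prob_space M
  for M :: "'a measure" +
  fixes w :: "'a \<Rightarrow> real ^ 'd"
    and x :: "nat \<Rightarrow> 'a \<Rightarrow> real ^ 'd"
    and \<epsilon> :: "nat \<Rightarrow> 'a \<Rightarrow> real"
    and \<Sigma>w :: "real ^ 'd ^ 'd"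
    and \<sigma>2 :: real
  assumes w_rv: "random_variable borel w"
    and x_rv: "\<And>k. random_variable borel (x k)"
    and eps_rv: "\<And>k. random_variable borel (\<epsilon> k)"
    and indep: "indep_sets (\<lambda>s. case s of
          Weight \<Rightarrow> sets (vimage_algebra (space M) w borel)
        | Input k \<Rightarrow> sets (vimage_algebra (space M) (x k) borel)
        | Noise k \<Rightarrow> sets (vimage_algebra (space M) (\<epsilon> k) borel)) UNIV"
      \<comment> \<open>\<open>indep_vars\<close> requires all variables to have the same range type, so mutual independence
          is stated for the generated sigma-algebras\<close>
    and w_gaussian: "gaussian_vec M w"
    and w_mean: "expectation w = 0"
    and w_cov: "expectation (\<lambda>\<omega>. outer (w \<omega>)) = \<Sigma>w"
    and eps_gaussian: "\<And>k. gaussian_rv M (\<epsilon> k)"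
    and eps_mean: "\<And>k. expectation (\<epsilon> k) = 0"
    and eps_var: "\<And>k. variance (\<epsilon> k) = \<sigma>2"
    and x_mean: "\<And>k. expectation (x k) = 0"
    and x_cov: "\<And>k. integrable M (\<lambda>\<omega>. outer (x k \<omega>))"

definition observation ::
    "('a \<Rightarrow> real ^ 'd) \<Rightarrow> (nat \<Rightarrow> 'a \<Rightarrow> real ^ 'd) \<Rightarrow> (nat \<Rightarrow> 'a \<Rightarrow> real) \<Rightarrow> nat \<Rightarrow> 'a \<Rightarrow> real" where
  "observation w x \<epsilon> k \<omega> = w \<omega> \<bullet> x k \<omega> + \<epsilon> k \<omega>"

primrec estimate :: "(nat \<Rightarrow> 'a \<Rightarrow> real ^ 'd) \<Rightarrow> nat \<Rightarrow> 'a \<Rightarrow> real ^ 'd" where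
  "estimate u 0 = (\<lambda>\<omega>. 0)"
| "estimate u (Suc k) = (\<lambda>\<omega>. estimate u k \<omega> + u k \<omega>)"

definition est_error ::
    "('a \<Rightarrow> real ^ 'd) \<Rightarrow> (nat \<Rightarrow> 'a \<Rightarrow> real ^ 'd) \<Rightarrow> nat \<Rightarrow> 'a \<Rightarrow> real ^ 'd" where
  "est_error w u k \<omega> = estimate u k \<omega> - w \<omega>"

definition output_error ::
    "('a \<Rightarrow> real ^ 'd) \<Rightarrow> (nat \<Rightarrow> 'a \<Rightarrow> real ^ 'd) \<Rightarrow> (nat \<Rightarrow> 'a \<Rightarrow> real) \<Rightarrow>
     (nat \<Rightarrow> 'a \<Rightarrow> real ^ 'd) \<Rightarrow> nat \<Rightarrow> 'a \<Rightarrow> real" where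
  "output_error w x \<epsilon> u k \<omega> = estimate u k \<omega> \<bullet> x k \<omega> - observation w x \<epsilon> k \<omega>"

type_synonym 'd info = "(nat \<Rightarrow> (real ^ 'd) \<times> real) \<times> (nat \<Rightarrow> real ^ 'd)"

definition info_space :: "nat \<Rightarrow> ('d::finite) info measure" where
  "info_space k = (\<Pi>\<^sub>M j\<in>{..k}. borel) \<Otimes>\<^sub>M (\<Pi>\<^sub>M j\<in>{..<k}. borel)"

text \<open>
  The vectors \<open>I\<^sub>k\<close> and \<open>\<tilde>I\<^sub>k\<close>: the first component collects the pairs
  of inputs and outputs (respectively output errors) at times \<open>0, \<dots>, k\<close>, the second one the
  updates at times \<open>0, \<dots>, k - 1\<close>.
\<close>

definition info_vec ::
    "('a \<Rightarrow> real ^ 'd) \<Rightarrow> (nat \<Rightarrow> 'a \<Rightarrow> real ^ 'd) \<Rightarrow> (nat \<Rightarrow> 'a \<Rightarrow> real) \<Rightarrow>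
     (nat \<Rightarrow> 'a \<Rightarrow> real ^ 'd) \<Rightarrow> nat \<Rightarrow> 'a \<Rightarrow> ('d::finite) info" where
  "info_vec w x \<epsilon> u k \<omega> =
     (\<lambda>j\<in>{..k}. (x j \<omega>, observation w x \<epsilon> j \<omega>), \<lambda>j\<in>{..<k}. u j \<omega>)"

definition info_vec_tilde ::
    "('a \<Rightarrow> real ^ 'd) \<Rightarrow> (nat \<Rightarrow> 'a \<Rightarrow> real ^ 'd) \<Rightarrow> (nat \<Rightarrow> 'a \<Rightarrow> real) \<Rightarrow>
     (nat \<Rightarrow> 'a \<Rightarrow> real ^ 'd) \<Rightarrow> nat \<Rightarrow> 'a \<Rightarrow> ('d::finite) info" where
  "info_vec_tilde w x \<epsilon> u k \<omega> =
     (\<lambda>j\<in>{..k}. (x j \<omega>, output_error w x \<epsilon> u j \<omega>), \<lambda>j\<in>{..<k}. u j \<omega>)"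

text \<open>
  Updates \<open>u\<^sub>0, \<dots>, u\<^bsub>N-1\<^esub>\<close> produced by (Borel) updating functions \<open>\<mu>\<^sub>k\<close>
  of the information vector; the values of \<open>u\<close> at later times are irrelevant.
\<close>

definition admissible_updates ::
    "'a measure \<Rightarrow> ('a \<Rightarrow> real ^ 'd) \<Rightarrow> (nat \<Rightarrow> 'a \<Rightarrow> real ^ 'd) \<Rightarrow> (nat \<Rightarrow> 'a \<Rightarrow> real) \<Rightarrow>
     nat \<Rightarrow> (nat \<Rightarrow> 'a \<Rightarrow> real ^ 'd) \<Rightarrow> bool" where
  "admissible_updates M w x \<epsilon> N u \<longleftrightarrow>
     (\<forall>k<N. \<exists>\<mu> \<in> borel_measurable (info_space k).
        \<forall>\<omega>\<in>space M. u k \<omega> = \<mu> (info_vec w x \<epsilon> u k \<omega>))"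

text \<open>
  Expectations of nonnegative quantities are taken in \<open>[0, \<infinity>]\<close>, so that updates without second
  moments have infinite cost.
\<close>

definition oll_cost ::
    "'a measure \<Rightarrow> ('a \<Rightarrow> real ^ 'd) \<Rightarrow> (nat \<Rightarrow> 'a \<Rightarrow> real ^ 'd) \<Rightarrow> real \<Rightarrow> nat \<Rightarrow>
     (nat \<Rightarrow> 'a \<Rightarrow> real ^ 'd) \<Rightarrow> ennreal" where
  "oll_cost M w x \<gamma> N u =
     (\<integral>\<^sup>+\<omega>. ennreal (
        (\<Sum>k<N. est_error w u k \<omega> \<bullet> (outer (x k \<omega>) *v est_error w u k \<omega>)
               + \<gamma> * (u k \<omega> \<bullet> u k \<omega>))
        + est_error w u N \<omega> \<bullet> (outer (x N \<omega>) *v est_error w u N \<omega>)) \<partial>M)"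

definition oll_optimal ::
    "'a measure \<Rightarrow> ('a \<Rightarrow> real ^ 'd) \<Rightarrow> (nat \<Rightarrow> 'a \<Rightarrow> real ^ 'd) \<Rightarrow> (nat \<Rightarrow> 'a \<Rightarrow> real) \<Rightarrow>
     real \<Rightarrow> nat \<Rightarrow> (nat \<Rightarrow> 'a \<Rightarrow> real ^ 'd) \<Rightarrow> bool" where
  "oll_optimal M w x \<epsilon> \<gamma> N u \<longleftrightarrow>
     admissible_updates M w x \<epsilon> N u \<and>
     (\<forall>v. admissible_updates M w x \<epsilon> N v \<longrightarrow> oll_cost M w x \<gamma> N u \<le> oll_cost M w x \<gamma> N v)"

definition kalman_updates ::
    "'a measure \<Rightarrow> ('a \<Rightarrow> real ^ 'd) \<Rightarrow> (nat \<Rightarrow> 'a \<Rightarrow> real ^ 'd) \<Rightarrow> (nat \<Rightarrow> 'a \<Rightarrow> real) \<Rightarrow>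
     nat \<Rightarrow> (nat \<Rightarrow> 'a \<Rightarrow> real ^ 'd) \<Rightarrow> bool" where
  "kalman_updates M w x \<epsilon> N u \<longleftrightarrow>
     admissible_updates M w x \<epsilon> N u \<and>
     (\<forall>k<N. AE \<omega> in M. u k \<omega> =
        - vec_cond_exp M
            (vimage_algebra (space M) (info_vec_tilde w x \<epsilon> u k) (info_space k))
            (est_error w u k) \<omega>)"

end

(*
  By independence of the inputs, the expected cost is quadratic in the updates, with weights that
  are second moments of the inputs, and the admissible updates are exactly the sequences adapted to
  the observations. The first-order condition in a suitable direction shows that each optimal
  update u has E (u . e) <= 0, where e is the error after the update; the Kalman errors are
  orthogonal to the observations. Hence, for the difference D_k of the Kalman and the optimal
  estimates, E |D_k|^2 + E |uk_k|^2 = E |D_k + uk_k|^2 = E |D_{k+1} + uo_k|^2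
  >= E |D_{k+1}|^2 + E |uo_k|^2 (uk, uo the Kalman and optimal updates), which telescopes from
  D_0 = 0.
*)
theory Submission
  imports Defs
begin

text \<open>The updates cannot be compared time by time: an optimal update removes only part of the
  estimated error, so a later optimal update may well exceed the Kalman one. The square of D_k
  accounts for this accumulated lag. The condition E (u . e) <= 0 says that an update does not
  overshoot on average. In terms of gains it reflects that L_k (I + L_k) = -\<gamma> K (K + \<gamma>
  I)^{-2} is negative semidefinite, where K is the cost matrix at time k+1. Here, however, the
  optimal updates are given only as minimizers of a cost with values in [0, \<infinity>], so that
  neither gains nor second moments are at hand; both integrability and the sign have to come from
  comparison with other admissible updates. The direction of comparison is the part of the later
  errors that is predictable at time k: changing the updates so that every estimate after time k
  loses t times this part uses no information from after time k, and it turns the first variation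
  into squares plus the wanted inner product.\<close>

section \<open>Square integrability and conditional means\<close>

definition sq_integrable :: "'a measure \<Rightarrow> ('a \<Rightarrow> 'b::euclidean_space) \<Rightarrow> bool" where
  "sq_integrable M f \<longleftrightarrow> f \<in> borel_measurable M \<and> integrable M (\<lambda>\<omega>. f \<omega> \<bullet> f \<omega>)"

lemma sq_integrable_measurable [measurable_dest]:
  "sq_integrable M f \<Longrightarrow> f \<in> borel_measurable M"
  by (simp add: sq_integrable_def)

text \<open>Expanding the nonnegative squares of \<open>a + b\<close> and \<open>a - b\<close>
  bounds the absolute value of \<open>a \<bullet> b\<close> by
  \<open>a \<bullet> a + b \<bullet> b\<close>; the sharper factor 1/2 is dropped.\<close>

lemma sq_integrable_inner:
  assumes "sq_integrable M f" "sq_integrable M g"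
  shows "integrable M (\<lambda>\<omega>. f \<omega> \<bullet> g \<omega>)"
proof (rule Bochner_Integration.integrable_bound)
  show "integrable M (\<lambda>\<omega>. f \<omega> \<bullet> f \<omega> + g \<omega> \<bullet> g \<omega>)"
    using assms by (simp add: sq_integrable_def)
  show "(\<lambda>\<omega>. f \<omega> \<bullet> g \<omega>) \<in> borel_measurable M"
    using assms by measurable
  have "\<bar>a \<bullet> b\<bar> \<le> a \<bullet> a + b \<bullet> b" for a b :: 'b
  proof -
    have "0 \<le> (a + b) \<bullet> (a + b)" "0 \<le> (a - b) \<bullet> (a - b)" "0 \<le> a \<bullet> a" "0 \<le> b \<bullet> b" by auto
    then show ?thesis by (simp add: inner_add_left inner_add_right inner_diff_left inner_diff_right inner_commute)
  qed
  then show "AE \<omega> in M. norm (f \<omega> \<bullet> g \<omega>) \<le> norm (f \<omega> \<bullet> f \<omega> + g \<omega> \<bullet> g \<omega>)"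
    by (auto intro: order_trans)
qed

lemma sq_integrable_0 [simp]: "sq_integrable M (\<lambda>_. 0)"
  by (simp add: sq_integrable_def)

lemma sq_integrable_add:
  assumes "sq_integrable M f" "sq_integrable M g"
  shows "sq_integrable M (\<lambda>\<omega>. f \<omega> + g \<omega>)"
  using assms sq_integrable_inner[OF assms] sq_integrable_inner[OF assms(2,1)]
  unfolding sq_integrable_def by (auto simp: inner_add_left inner_add_right intro!: borel_measurable_add)

lemma sq_integrable_diff:
  assumes "sq_integrable M f" "sq_integrable M g"
  shows "sq_integrable M (\<lambda>\<omega>. f \<omega> - g \<omega>)"
  using assms sq_integrable_inner[OF assms] sq_integrable_inner[OF assms(2,1)]
  unfolding sq_integrable_def by (auto simp: inner_diff_left inner_diff_right intro!: borel_measurable_diff)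

lemma sq_integrable_minus:
  "sq_integrable M f \<Longrightarrow> sq_integrable M (\<lambda>\<omega>. - f \<omega>)"
  by (simp add: sq_integrable_def)

lemma sq_integrable_cong_AE:
  assumes "sq_integrable M f" "g \<in> borel_measurable M" "AE \<omega> in M. g \<omega> = f \<omega>"
  shows "sq_integrable M g"
proof -
  have "integrable M (\<lambda>\<omega>. g \<omega> \<bullet> g \<omega>) = integrable M (\<lambda>\<omega>. f \<omega> \<bullet> f \<omega>)"
    using assms by (intro integrable_cong_AE) (auto simp: sq_integrable_def)
  then show ?thesis
    using assms by (simp add: sq_integrable_def)
qed

lemma borel_measurable_vec_iff:
  fixes f :: "'a \<Rightarrow> real ^ 'd"
  shows "f \<in> borel_measurable M \<longleftrightarrow> (\<forall>i. (\<lambda>\<omega>. f \<omega> $ i) \<in> borel_measurable M)"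
proof -
  have "(\<forall>b\<in>Basis. (\<lambda>\<omega>. f \<omega> \<bullet> b) \<in> borel_measurable M) \<longleftrightarrow> (\<forall>i. (\<lambda>\<omega>. f \<omega> $ i) \<in> borel_measurable M)"
    by (auto simp: Basis_vec_def inner_axis)
  then show ?thesis
    using borel_measurable_euclidean_space[of f M] by simp
qed

text \<open>The bridge to scalar theory: conditional means, and products with entries of x_k x_k',
  are handled coordinate by coordinate. A squared coordinate is at most the squared norm, which in
  turn is a finite sum of such squares.\<close>

lemma sq_integrable_vec_iff:
  fixes f :: "'a \<Rightarrow> real ^ 'd"
  shows "sq_integrable M f \<longleftrightarrow> (\<forall>i. sq_integrable M (\<lambda>\<omega>. f \<omega> $ i))"
proof (intro iffI allI)
  fix i assume f: "sq_integrable M f"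
  have "(f \<omega> $ i) * (f \<omega> $ i) \<le> f \<omega> \<bullet> f \<omega>" for \<omega>
    unfolding inner_vec_def inner_real_def
    by (rule member_le_sum[where f = "\<lambda>i. f \<omega> $ i * f \<omega> $ i"]) auto
  moreover have [measurable]: "(\<lambda>\<omega>. f \<omega> $ i) \<in> borel_measurable M"
    using f by (auto simp: sq_integrable_def borel_measurable_vec_iff[of f])
  ultimately show "sq_integrable M (\<lambda>\<omega>. f \<omega> $ i)"
    using f unfolding sq_integrable_def
    by (auto intro!: Bochner_Integration.integrable_bound[of M "\<lambda>\<omega>. f \<omega> \<bullet> f \<omega>"])
next
  assume "\<forall>i. sq_integrable M (\<lambda>\<omega>. f \<omega> $ i)"
  then show "sq_integrable M f"
    by (auto simp: sq_integrable_def borel_measurable_vec_iff[of f] inner_vec_def)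
qed

context prob_space
begin

lemma subalgebra_sigma_finite:
  "subalgebra M F \<Longrightarrow> sigma_finite_subalgebra M F"
  by (intro finite_measure_subalgebra_is_sigma_finite)
    (simp add: finite_measure_subalgebra_def finite_measure_subalgebra_axioms_def finite_measure_axioms)

lemma sq_integrable_integrable:
  fixes f :: "'a \<Rightarrow> real"
  assumes "sq_integrable M f"
  shows "integrable M f"
  using sq_integrable_inner[OF assms, of "\<lambda>_. 1"] by (simp add: sq_integrable_def)

text \<open>Conditional Jensen for the square: the squared conditional mean is dominated by the
  conditional mean of the square, which is integrable.\<close>

lemma sq_integrable_real_cond_exp:
  assumes F: "subalgebra M F" and f: "sq_integrable M f"
  shows "sq_integrable M (real_cond_exp M F f)"
proof -
  interpret sigma_finite_subalgebra M F by (rule subalgebra_sigma_finite[OF F])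
  have sq: "integrable M (\<lambda>\<omega>. (f \<omega>)\<^sup>2)"
    using f by (simp add: sq_integrable_def power2_eq_square)
  have "AE \<omega> in M. (real_cond_exp M F f \<omega>)\<^sup>2 \<le> real_cond_exp M F (\<lambda>\<omega>. (f \<omega>)\<^sup>2) \<omega>"
    by (rule real_cond_exp_jensens_inequality(2)[where I = UNIV])
      (use sq sq_integrable_integrable[OF f] in \<open>auto intro: convex_power2\<close>)
  then have "integrable M (\<lambda>\<omega>. (real_cond_exp M F f \<omega>)\<^sup>2)"
    by (intro Bochner_Integration.integrable_bound[OF real_cond_exp_int(1)[OF sq]])
      (auto elim!: eventually_mono intro: order_trans)
  then show ?thesis
    by (simp add: sq_integrable_def power2_eq_square)
qed

lemma vec_cond_exp_measurable:
  "vec_cond_exp M F f \<in> borel_measurable F"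
  by (subst borel_measurable_vec_iff) (simp add: vec_cond_exp_def)

lemma sq_integrable_vec_cond_exp:
  assumes "subalgebra M F" "sq_integrable M f"
  shows "sq_integrable M (vec_cond_exp M F f)"
  using assms sq_integrable_real_cond_exp[OF assms(1)]
  by (simp add: sq_integrable_vec_iff[of M f] sq_integrable_vec_iff[of M "vec_cond_exp M F f"] vec_cond_exp_def)

text \<open>Stated for a scalar multiplier and a single coordinate because the input weights couple
  coordinate \<open>a\<close> of one vector with coordinate \<open>b\<close> of another; the
  inner-product version below is only the diagonal sum.\<close>

lemma integral_mult_vec_cond_exp:
  fixes g :: "'a \<Rightarrow> real"
  assumes F: "subalgebra M F" and f: "sq_integrable M f"
    and g: "sq_integrable M g" "g \<in> borel_measurable F"
  shows "(\<integral>\<omega>. g \<omega> * vec_cond_exp M F f \<omega> $ i \<partial>M) = (\<integral>\<omega>. g \<omega> * f \<omega> $ i \<partial>M)"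
proof -
  interpret sigma_finite_subalgebra M F by (rule subalgebra_sigma_finite[OF F])
  have fi: "sq_integrable M (\<lambda>\<omega>. f \<omega> $ i)"
    using f by (simp add: sq_integrable_vec_iff[of M f])
  have "integrable M (\<lambda>\<omega>. g \<omega> * f \<omega> $ i)"
    using sq_integrable_inner[OF g(1) fi] by simp
  from real_cond_exp_intg(2)[OF this g(2) sq_integrable_measurable[OF fi]] show ?thesis
    by (simp add: vec_cond_exp_def)
qed

lemma integral_inner_vec_cond_exp:
  assumes F: "subalgebra M F" and f: "sq_integrable M f"
    and g: "sq_integrable M g" "g \<in> borel_measurable F"
  shows "(\<integral>\<omega>. g \<omega> \<bullet> vec_cond_exp M F f \<omega> \<partial>M) = (\<integral>\<omega>. g \<omega> \<bullet> f \<omega> \<partial>M)"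
proof -
  have int: "integrable M (\<lambda>\<omega>. g \<omega> $ i * h \<omega> $ i)" if "sq_integrable M h" for h :: "'a \<Rightarrow> real ^ 'b" and i
    using that g(1) sq_integrable_inner[of M "\<lambda>\<omega>. g \<omega> $ i" "\<lambda>\<omega>. h \<omega> $ i"]
    by (simp add: sq_integrable_vec_iff[of M h] sq_integrable_vec_iff[of M g])
  have "sq_integrable M (\<lambda>\<omega>. g \<omega> $ i)" "(\<lambda>\<omega>. g \<omega> $ i) \<in> borel_measurable F" for i
    using g by (simp_all add: sq_integrable_vec_iff[of M g] borel_measurable_vec_iff[of g])
  from integral_mult_vec_cond_exp[OF F f this] show ?thesis
    using int[OF f] int[OF sq_integrable_vec_cond_exp[OF F f]] by (simp add: inner_vec_def)
qed

text \<open>In the nondegenerate case the second central moment of the normal density is integrable,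
  and adding the constant \<mu> back preserves square integrability.\<close>

lemma gaussian_rv_sq_integrable:
  assumes "gaussian_rv M X"
  shows "sq_integrable M X"
proof -
  have [measurable]: "X \<in> borel_measurable M" using assms by (simp add: gaussian_rv_def)
  consider c where "AE \<omega> in M. X \<omega> = c"
    | \<mu> \<sigma> where "\<sigma> > 0" "distributed M lborel X (\<lambda>t. ennreal (normal_density \<mu> \<sigma> t))"
    using assms unfolding gaussian_rv_def by blast
  then show ?thesis
  proof cases
    case 1
    show ?thesis
      by (rule sq_integrable_cong_AE[OF _ _ 1]) (simp_all add: sq_integrable_def)
  next
    case 2
    have "integrable lborel (\<lambda>t. normal_density \<mu> \<sigma> t * (t - \<mu>)\<^sup>2)"
      by (rule integrable_normal_moment[OF 2(1)])
    then have "integrable M (\<lambda>\<omega>. (X \<omega> - \<mu>)\<^sup>2)"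
      by (subst (asm) distributed_integrable[OF 2(2)]) simp_all
    then have "sq_integrable M (\<lambda>\<omega>. X \<omega> - \<mu>)"
      by (simp add: sq_integrable_def power2_eq_square)
    from sq_integrable_add[OF this, of "\<lambda>_. \<mu>"] show ?thesis
      by (simp add: sq_integrable_def)
  qed
qed

end

section \<open>Factorization of measurable functions through a generating map\<close>

text \<open>Induction over nonnegative measurable functions: the sets of the generated algebra are
  preimages, so their indicators factor, and factorizations survive scaling, sums and monotone
  limits.\<close>

lemma Doob_Dynkin_nonneg:
  fixes u :: "'a \<Rightarrow> real"
  assumes "u \<in> borel_measurable (vimage_algebra X f N)" "\<And>\<omega>. 0 \<le> u \<omega>" and f: "f \<in> X \<rightarrow> space N"
  shows "\<exists>h\<in>borel_measurable N. \<forall>\<omega>\<in>X. u \<omega> = h (f \<omega>)"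
  using assms(1,2)
proof (induction rule: borel_measurable_induct_real)
  case (set A)
  then obtain B where "B \<in> sets N" "A = f -` B \<inter> X"
    by (auto simp: sets_vimage_algebra2[OF f])
  then show ?case
    by (intro bexI[of _ "indicator B"] ballI) (simp_all add: indicator_def)
next
  case (mult u c)
  from mult.IH obtain h where "h \<in> borel_measurable N" "\<forall>\<omega>\<in>X. u \<omega> = h (f \<omega>)" by blast
  then show ?case
    by (intro bexI[of _ "\<lambda>y. c * h y"] ballI) simp_all
next
  case (add u v)
  from add.IH obtain h k where "h \<in> borel_measurable N" "\<forall>\<omega>\<in>X. u \<omega> = h (f \<omega>)"
      "k \<in> borel_measurable N" "\<forall>\<omega>\<in>X. v \<omega> = k (f \<omega>)" by blast
  then show ?case
    by (intro bexI[of _ "\<lambda>y. k y + h y"] ballI) simp_all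
next
  case (seq U)
  from seq.IH obtain h where h: "\<And>i. h i \<in> borel_measurable N" "\<And>i. \<forall>\<omega>\<in>X. U i \<omega> = h i (f \<omega>)"
    by metis
  \<comment> \<open>Off the range of \<open>f\<close> the functions \<open>h i\<close> need not
    converge. The total operator \<open>lim\<close> takes some value there and is still measurable
    in \<open>y\<close>.\<close>
  show ?case
  proof (intro bexI[of _ "\<lambda>y. lim (\<lambda>i. h i y)"] ballI)
    fix \<omega> assume "\<omega> \<in> X"
    then have "(\<lambda>i. h i (f \<omega>)) \<longlonglongrightarrow> u \<omega>"
      using seq.hyps(4)[of \<omega>] h(2) by simp
    then show "u \<omega> = lim (\<lambda>i. h i (f \<omega>))"
      by (simp add: limI)
  qed (use h in measurable)
qed

text \<open>Coordinates reduce the vector case to real functions, whose positive and negative parts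
  factor separately.\<close>

lemma Doob_Dynkin:
  fixes u :: "'a \<Rightarrow> real ^ 'd"
  assumes u: "u \<in> borel_measurable (vimage_algebra X f N)" and f: "f \<in> X \<rightarrow> space N"
  shows "\<exists>h\<in>borel_measurable N. \<forall>\<omega>\<in>X. u \<omega> = h (f \<omega>)"
proof -
  have ui: "(\<lambda>\<omega>. u \<omega> $ i) \<in> borel_measurable (vimage_algebra X f N)" for i
    using u by (simp add: borel_measurable_vec_iff[of u])
  have "\<forall>i. \<exists>h\<in>borel_measurable N. \<forall>\<omega>\<in>X. u \<omega> $ i = h (f \<omega>)"
  proof
    fix i
    have factor: "\<exists>h\<in>borel_measurable N. \<forall>\<omega>\<in>X. max (g \<omega>) 0 = h (f \<omega>)"
      if "g \<in> borel_measurable (vimage_algebra X f N)" for g :: "'a \<Rightarrow> real"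
      by (rule Doob_Dynkin_nonneg[OF _ _ f]) (use that in simp_all)
    obtain p where p: "p \<in> borel_measurable N" "\<forall>\<omega>\<in>X. max (u \<omega> $ i) 0 = p (f \<omega>)"
      using factor[OF ui] by blast
    obtain q where q: "q \<in> borel_measurable N" "\<forall>\<omega>\<in>X. max (- u \<omega> $ i) 0 = q (f \<omega>)"
      using factor[OF borel_measurable_uminus[OF ui]] by blast
    show "\<exists>h\<in>borel_measurable N. \<forall>\<omega>\<in>X. u \<omega> $ i = h (f \<omega>)"
    proof (intro bexI[of _ "\<lambda>y. p y - q y"] ballI)
      fix \<omega> assume "\<omega> \<in> X"
      have "u \<omega> $ i = max (u \<omega> $ i) 0 - max (- u \<omega> $ i) 0" by simp
      then show "u \<omega> $ i = p (f \<omega>) - q (f \<omega>)"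
        using p q \<open>\<omega> \<in> X\<close> by simp
    qed (use p q in measurable)
  qed
  then obtain h where h: "\<And>i. h i \<in> borel_measurable N" "\<And>i. \<forall>\<omega>\<in>X. u \<omega> $ i = h i (f \<omega>)"
    by metis
  show ?thesis
    using h by (intro bexI[of _ "\<lambda>y. \<chi> i. h i y"] ballI) (simp_all add: vec_eq_iff borel_measurable_vec_iff)
qed

lemma measurable_sets_subset:
  assumes "f \<in> measurable F N" "space F = space G" "sets F \<subseteq> sets G"
  shows "f \<in> measurable G N"
  using assms by (auto simp: measurable_def)

lemma inner_outer:
  "e \<bullet> (outer v *v e) = (v \<bullet> e)\<^sup>2"
proof -
  have "outer v *v e = (v \<bullet> e) *\<^sub>R v"
    by (simp add: vec_eq_iff outer_def matrix_vector_mult_def inner_vec_def sum_distrib_left mult_ac)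
  then show ?thesis
    by (simp add: power2_eq_square inner_commute)
qed

text \<open>The derivative test at 0 for a minimizer of a quadratic polynomial in \<open>t\<close>,
  with one explicit \<open>t\<close> in place of a limit.\<close>

lemma nonpos_if_quadratic_nonneg:
  fixes b c :: real
  assumes "\<And>t. t > 0 \<Longrightarrow> 2 * t * b \<le> t\<^sup>2 * c"
  shows "b \<le> 0"
proof (rule ccontr)
  assume "\<not> b \<le> 0"
  then have b: "b > 0" by simp
  \<comment> \<open>This \<open>t\<close> makes \<open>t * c\<close> at most \<open>b\<close>,
    against the bound \<open>2 * b \<le> t * c\<close>; the added 1 keeps the denominator positive
    when \<open>c\<close> is 0.\<close>
  define t where "t = b / (\<bar>c\<bar> + 1)"
  have t: "t > 0" using b by (simp add: t_def)
  have "t * (2 * b) \<le> t * (t * c)"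
    using assms[OF t] by (simp add: power2_eq_square mult_ac)
  then have "2 * b \<le> t * c" using t by simp
  also have "\<dots> \<le> t * (\<bar>c\<bar> + 1)" using t by (intro mult_left_mono) auto
  also have "\<dots> = b" by (simp add: t_def)
  finally show False using b by simp
qed

lemma estimate_measurable:
  "(\<And>i. i < k \<Longrightarrow> u i \<in> borel_measurable F) \<Longrightarrow> estimate u k \<in> borel_measurable F"
  by (induction k) (auto intro!: borel_measurable_add)

lemma sq_integrable_estimate:
  "(\<And>i. i < k \<Longrightarrow> sq_integrable M (u i)) \<Longrightarrow> sq_integrable M (estimate u k)"
  by (induction k) (auto intro!: sq_integrable_add)

section \<open>Observations, independent sources and the past\<close>

context learning_model
begin

text \<open>The updates are left out of the generators, so that one filtration serves all admissible
  updates at once, the optimal and the Kalman ones in particular.\<close>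

definition obs_algebra :: "nat \<Rightarrow> 'a measure" where
  "obs_algebra k = vimage_algebra (space M)
     (\<lambda>\<omega>. \<lambda>j\<in>{..k}. (x j \<omega>, observation w x \<epsilon> j \<omega>)) (\<Pi>\<^sub>M j\<in>{..k}. borel)"

text \<open>A name for the family in the independence assumption of the locale, written in the same
  form so that the assumption can be folded.\<close>

definition source_events :: "source \<Rightarrow> 'a set set" where
  "source_events s = (case s of
          Weight \<Rightarrow> sets (vimage_algebra (space M) w borel)
        | Input k \<Rightarrow> sets (vimage_algebra (space M) (x k) borel)
        | Noise k \<Rightarrow> sets (vimage_algebra (space M) (\<epsilon> k) borel))"

text \<open>The sources on which an error at time \<open>k\<close> can depend. The indices are
  strictly below \<open>k\<close>: the error is formed before x_k enters, which makes it independent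
  of x_k.\<close>

definition past_sources :: "nat \<Rightarrow> source set" where
  "past_sources k = insert Weight (Input ` {..<k} \<union> Noise ` {..<k})"

definition past_algebra :: "nat \<Rightarrow> 'a measure" where
  "past_algebra k = sigma (space M) (\<Union>s\<in>past_sources k. source_events s)"

lemma space_obs_algebra [simp]: "space (obs_algebra k) = space M"
  by (simp add: obs_algebra_def)

lemma source_events_subset: "source_events s \<subseteq> events"
proof (cases s)
  case Weight
  then show ?thesis
    using sets_image_in_sets[OF refl w_rv] by (simp add: source_events_def)
next
  case (Input k)
  then show ?thesis
    using sets_image_in_sets[OF refl x_rv[of k]] by (simp add: source_events_def)
next
  case (Noise k)
  then show ?thesis
    using sets_image_in_sets[OF refl eps_rv[of k]] by (simp add: source_events_def)
qed

lemma past_generators: "(\<Union>s\<in>past_sources k. source_events s) \<subseteq> Pow (space M)"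
  using source_events_subset sets.space_closed by blast

lemma space_past_algebra [simp]: "space (past_algebra k) = space M"
  unfolding past_algebra_def by (rule space_measure_of[OF past_generators])

lemma sets_past_algebra:
  "sets (past_algebra k) = sigma_sets (space M) (\<Union>s\<in>past_sources k. source_events s)"
  unfolding past_algebra_def by (rule sets_measure_of[OF past_generators])

lemma subalgebra_past: "subalgebra M (past_algebra k)"
proof -
  have "sigma_sets (space M) (\<Union>s\<in>past_sources k. source_events s) \<subseteq> events"
    using source_events_subset by (intro sets.sigma_sets_subset) blast
  then show ?thesis
    by (simp add: subalgebra_def sets_past_algebra)
qed

lemma source_events_past: "s \<in> past_sources k \<Longrightarrow> source_events s \<subseteq> sets (past_algebra k)"
  unfolding sets_past_algebra by (auto intro: sigma_sets.Basic)

lemma measurable_past_sources: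
  shows "w \<in> borel_measurable (past_algebra k)"
    and "j < k \<Longrightarrow> x j \<in> borel_measurable (past_algebra k)"
    and "j < k \<Longrightarrow> \<epsilon> j \<in> borel_measurable (past_algebra k)"
proof -
  have *: "f \<in> borel_measurable (past_algebra k)"
    if "sets (vimage_algebra (space M) f borel) \<subseteq> sets (past_algebra k)"
    for f :: "'a \<Rightarrow> 'b :: topological_space"
    by (rule measurable_sets_subset[OF measurable_vimage_algebra1]) (use that in auto)
  show "w \<in> borel_measurable (past_algebra k)"
    using source_events_past[of Weight k] by (intro *) (simp add: source_events_def past_sources_def)
  show "x j \<in> borel_measurable (past_algebra k)" if "j < k"
    using source_events_past[of "Input j" k] that by (intro *) (simp add: source_events_def past_sources_def)
  show "\<epsilon> j \<in> borel_measurable (past_algebra k)" if "j < k"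
    using source_events_past[of "Noise j" k] that by (intro *) (simp add: source_events_def past_sources_def)
qed

text \<open>Minimality of the generated algebra. It yields monotonicity in time, the inclusion in
  the past, and later the inclusion in the algebra of the information vector of the Kalman
  updates.\<close>

lemma obs_algebra_subset:
  assumes "space F = space M"
    and "\<And>j. j \<le> k \<Longrightarrow> x j \<in> borel_measurable F"
    and "\<And>j. j \<le> k \<Longrightarrow> observation w x \<epsilon> j \<in> borel_measurable F"
  shows "sets (obs_algebra k) \<subseteq> sets F"
  unfolding obs_algebra_def using assms
  by (intro sets_image_in_sets measurable_restrict borel_measurable_Pair) auto

lemma obs_algebra_measurable:
  assumes "j \<le> k"
  shows "x j \<in> borel_measurable (obs_algebra k)"
    and "observation w x \<epsilon> j \<in> borel_measurable (obs_algebra k)"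
proof -
  have "(\<lambda>\<omega>. \<lambda>j\<in>{..k}. (x j \<omega>, observation w x \<epsilon> j \<omega>)) \<in> measurable (obs_algebra k) (\<Pi>\<^sub>M j\<in>{..k}. borel)"
    unfolding obs_algebra_def by (rule measurable_vimage_algebra1) (auto simp: space_PiM)
  from measurable_compose[OF this measurable_component_singleton[of j]] assms
  have "(\<lambda>\<omega>. (x j \<omega>, observation w x \<epsilon> j \<omega>)) \<in> borel_measurable (obs_algebra k)"
    by simp
  then have *: "(\<lambda>\<omega>. (x j \<omega>, observation w x \<epsilon> j \<omega>)) \<in> measurable (obs_algebra k) (borel \<Otimes>\<^sub>M borel)"
    by (simp add: borel_prod)
  show "x j \<in> borel_measurable (obs_algebra k)"
    using measurable_compose[OF * measurable_fst] by simp
  show "observation w x \<epsilon> j \<in> borel_measurable (obs_algebra k)"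
    using measurable_compose[OF * measurable_snd] by simp
qed

lemma obs_algebra_mono: "j \<le> k \<Longrightarrow> sets (obs_algebra j) \<subseteq> sets (obs_algebra k)"
  by (rule obs_algebra_subset) (auto intro: obs_algebra_measurable)

lemma obs_algebra_past: "j < k \<Longrightarrow> sets (obs_algebra j) \<subseteq> sets (past_algebra k)"
proof (rule obs_algebra_subset)
  fix i assume "j < k" "i \<le> j"
  then have "i < k" by simp
  then show "x i \<in> borel_measurable (past_algebra k)"
    by (rule measurable_past_sources)
  show "observation w x \<epsilon> i \<in> borel_measurable (past_algebra k)"
    using measurable_past_sources[of k] measurable_past_sources(2,3)[OF \<open>i < k\<close>]
    unfolding observation_def[abs_def] by (intro borel_measurable_add borel_measurable_inner)
qed simp

lemma subalgebra_obs: "subalgebra M (obs_algebra k)"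
  using obs_algebra_past[OF lessI] subalgebra_past by (simp add: subalgebra_def) (rule subset_trans)

lemma borel_measurable_obs_mono:
  "f \<in> borel_measurable (obs_algebra j) \<Longrightarrow> j \<le> k \<Longrightarrow> f \<in> borel_measurable (obs_algebra k)"
  by (erule measurable_sets_subset) (simp_all add: obs_algebra_mono)

lemma borel_measurable_obs_past:
  "f \<in> borel_measurable (obs_algebra j) \<Longrightarrow> j < k \<Longrightarrow> f \<in> borel_measurable (past_algebra k)"
  by (erule measurable_sets_subset) (simp_all add: obs_algebra_past)

lemma borel_measurable_obs_M:
  "f \<in> borel_measurable (obs_algebra j) \<Longrightarrow> f \<in> borel_measurable M"
  by (rule measurable_from_subalg[OF subalgebra_obs])

text \<open>Since past updates are themselves functions of the observations, the admissible updates
  form a linear space: there is no dual effect.\<close>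

lemma admissible_updates_iff:
  "admissible_updates M w x \<epsilon> N u \<longleftrightarrow> (\<forall>k<N. u k \<in> borel_measurable (obs_algebra k))"
proof (intro iffI allI impI)
  fix k assume adm: "admissible_updates M w x \<epsilon> N u" and "k < N"
  from \<open>k < N\<close> show "u k \<in> borel_measurable (obs_algebra k)"
  proof (induction k rule: less_induct)
    case (less k)
    obtain \<mu> where \<mu>: "\<mu> \<in> borel_measurable (info_space k)"
        "\<forall>\<omega>\<in>space M. u k \<omega> = \<mu> (info_vec w x \<epsilon> u k \<omega>)"
      using adm less.prems unfolding admissible_updates_def by blast
    \<comment> \<open>The recorded earlier updates are already functions of the observations by the
      induction hypothesis, so the whole information vector is.\<close>
    have "u i \<in> borel_measurable (obs_algebra k)" if "i < k" for i
      by (rule borel_measurable_obs_mono[OF less.IH[OF that]]) (use less.prems that in linarith)+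
    then have "info_vec w x \<epsilon> u k \<in> measurable (obs_algebra k) (info_space k)"
      unfolding info_vec_def[abs_def] info_space_def
      by (intro measurable_Pair measurable_restrict borel_measurable_Pair obs_algebra_measurable; simp only: atMost_iff lessThan_iff)
    from measurable_compose[OF this \<mu>(1)]
    show "u k \<in> borel_measurable (obs_algebra k)"
      by (rule measurable_cong[THEN iffD1, rotated]) (use \<mu>(2) in simp)
  qed
next
  assume u: "\<forall>k<N. u k \<in> borel_measurable (obs_algebra k)"
  show "admissible_updates M w x \<epsilon> N u"
    unfolding admissible_updates_def
  proof (intro allI impI)
    fix k assume "k < N"
    then have "u k \<in> borel_measurable (vimage_algebra (space M)
       (\<lambda>\<omega>. \<lambda>j\<in>{..k}. (x j \<omega>, observation w x \<epsilon> j \<omega>)) (\<Pi>\<^sub>M j\<in>{..k}. borel))"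
      using u unfolding obs_algebra_def by blast
    moreover have "(\<lambda>\<omega>. \<lambda>j\<in>{..k}. (x j \<omega>, observation w x \<epsilon> j \<omega>)) \<in>
        space M \<rightarrow> space (\<Pi>\<^sub>M j\<in>{..k}. borel)"
      by (auto simp: space_PiM)
    ultimately obtain h where h: "h \<in> borel_measurable (\<Pi>\<^sub>M j\<in>{..k}. borel)"
        "\<forall>\<omega>\<in>space M. u k \<omega> = h (\<lambda>j\<in>{..k}. (x j \<omega>, observation w x \<epsilon> j \<omega>))"
      using Doob_Dynkin by blast
    show "\<exists>\<mu>\<in>borel_measurable (info_space k). \<forall>\<omega>\<in>space M. u k \<omega> = \<mu> (info_vec w x \<epsilon> u k \<omega>)"
    \<comment> \<open>The updating function reads only the observation component of the information
      vector and ignores the recorded updates.\<close>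
    proof (intro bexI[of _ "\<lambda>z. h (fst z)"] ballI)
      show "(\<lambda>z. h (fst z)) \<in> borel_measurable (info_space k)"
        unfolding info_space_def by (rule measurable_compose[OF measurable_fst h(1)])
    qed (use h(2) in \<open>simp add: info_vec_def\<close>)
  qed
qed

section \<open>Independence of the current input from the past\<close>

text \<open>Grouping mutually independent sources into disjoint blocks keeps the generated algebras
  independent; here the two blocks are \<open>Input k\<close> alone and
  \<open>past_sources k\<close>.\<close>

lemma indep_past:
  fixes f :: "'a \<Rightarrow> real" and g :: "real ^ 'd \<Rightarrow> real"
  assumes f: "f \<in> borel_measurable (past_algebra k)" and g: "g \<in> borel_measurable borel"
  shows "indep_var borel (\<lambda>\<omega>. g (x k \<omega>)) borel f"
proof -
  define I where "I = case_bool {Input k} (past_sources k)"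
  have "indep_sets source_events (\<Union>b\<in>UNIV. I b)"
    by (rule indep_sets_mono_index[OF _ indep[folded source_events_def[abs_def]]]) simp
  moreover have "Int_stable (source_events s)" for s
    by (cases s) (simp_all add: source_events_def sets.Int_stable)
  moreover have "disjoint_family_on I UNIV"
    by (auto simp: disjoint_family_on_def I_def past_sources_def split: bool.splits)
  ultimately have ind: "indep_sets (\<lambda>b. sigma_sets (space M) (\<Union>s\<in>I b. source_events s)) UNIV"
    by (intro indep_sets_collect_sigma) auto
  have "indep_set (sigma_sets (space M) (source_events (Input k))) (sets (past_algebra k))"
    unfolding indep_set_def
    by (rule indep_sets_mono_sets[OF ind]) (auto simp: I_def sets_past_algebra split: bool.splits)
  then have prod: "prob (a \<inter> b) = prob a * prob b"
    if "a \<in> source_events (Input k)" "b \<in> sets (past_algebra k)" for a b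
    using that by (auto simp: indep_sets2_eq)
  have meas: "(\<lambda>\<omega>. g (x k \<omega>)) \<in> borel_measurable M" "f \<in> borel_measurable M"
    using measurable_compose[OF x_rv g] measurable_from_subalg[OF subalgebra_past f] by auto
  show ?thesis
    unfolding indep_var_eq
      sets_vimage_algebra[symmetric] indep_sets2_eq
  proof (intro conjI ballI meas)
    have "x k \<in> borel_measurable (vimage_algebra (space M) (x k) borel)"
      by (rule measurable_vimage_algebra1) simp
    from sets_image_in_sets[OF space_vimage_algebra measurable_compose[OF this g]]
    have *: "sets (vimage_algebra (space M) (\<lambda>\<omega>. g (x k \<omega>)) borel) \<subseteq> source_events (Input k)"
      by (simp add: source_events_def)
    have **: "sets (vimage_algebra (space M) f borel) \<subseteq> sets (past_algebra k)"
      by (rule sets_image_in_sets[OF space_past_algebra f])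
    show "prob (a \<inter> b) = prob a * prob b"
      if "a \<in> sets (vimage_algebra (space M) (\<lambda>\<omega>. g (x k \<omega>)) borel)"
        "b \<in> sets (vimage_algebra (space M) f borel)" for a b
      using that * ** by (intro prod) auto
  qed (rule sets_image_in_sets[OF refl], rule meas)+
qed

text \<open>The entries of E{Q_k}.\<close>

definition input_moment :: "nat \<Rightarrow> 'd \<Rightarrow> 'd \<Rightarrow> real" where
  "input_moment k a b = expectation (\<lambda>\<omega>. x k \<omega> $ a * x k \<omega> $ b)"

lemma input_products_integrable: "integrable M (\<lambda>\<omega>. x k \<omega> $ a * x k \<omega> $ b)"
proof -
  have "bounded_linear (\<lambda>A :: real ^ 'd ^ 'd. A $ a $ b)"
    by (intro bounded_linear_compose[OF bounded_linear_vec_nth bounded_linear_vec_nth])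
  from integrable_bounded_linear[OF this x_cov[of k]] show ?thesis
    by (simp add: outer_def)
qed

text \<open>Square integrability of the factors alone would not make this product of four factors
  integrable. Expanded in coordinates, each summand is an entry of Q_k times a past variable, and
  independence gives both integrability and the factorization.\<close>

lemma
  assumes f: "sq_integrable M f" "f \<in> borel_measurable (past_algebra k)"
    and g: "sq_integrable M g" "g \<in> borel_measurable (past_algebra k)"
  shows integrable_input_inner_product: "integrable M (\<lambda>\<omega>. (x k \<omega> \<bullet> f \<omega>) * (x k \<omega> \<bullet> g \<omega>))"
    and expectation_input_inner_product: "expectation (\<lambda>\<omega>. (x k \<omega> \<bullet> f \<omega>) * (x k \<omega> \<bullet> g \<omega>)) =
      (\<Sum>a\<in>UNIV. \<Sum>b\<in>UNIV. input_moment k a b * expectation (\<lambda>\<omega>. f \<omega> $ a * g \<omega> $ b))"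
proof -
  have expand: "(x k \<omega> \<bullet> f \<omega>) * (x k \<omega> \<bullet> g \<omega>) =
      (\<Sum>a\<in>UNIV. \<Sum>b\<in>UNIV. (x k \<omega> $ a * x k \<omega> $ b) * (f \<omega> $ a * g \<omega> $ b))" for \<omega>
    by (simp add: inner_vec_def sum_product mult_ac)
  have int: "integrable M (\<lambda>\<omega>. f \<omega> $ a * g \<omega> $ b)" for a b
    using f(1) g(1) sq_integrable_inner[of M "\<lambda>\<omega>. f \<omega> $ a" "\<lambda>\<omega>. g \<omega> $ b"]
    by (simp add: sq_integrable_vec_iff[of M f] sq_integrable_vec_iff[of M g])
  have ind: "indep_var borel (\<lambda>\<omega>. x k \<omega> $ a * x k \<omega> $ b) borel (\<lambda>\<omega>. f \<omega> $ a * g \<omega> $ b)" for a b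
  proof (rule indep_past[where g = "\<lambda>v. v $ a * v $ b"])
    show "(\<lambda>\<omega>. f \<omega> $ a * g \<omega> $ b) \<in> borel_measurable (past_algebra k)"
      by (rule borel_measurable_times[OF f(2)[THEN borel_measurable_vec_iff[THEN iffD1, THEN spec]]
            g(2)[THEN borel_measurable_vec_iff[THEN iffD1, THEN spec]]])
    have "(\<lambda>v :: real ^ 'd. v $ c) \<in> borel_measurable borel" for c
      by (intro borel_measurable_continuous_onI continuous_intros)
    then show "(\<lambda>v :: real ^ 'd. v $ a * v $ b) \<in> borel_measurable borel"
      by (intro borel_measurable_times)
  qed
  show "integrable M (\<lambda>\<omega>. (x k \<omega> \<bullet> f \<omega>) * (x k \<omega> \<bullet> g \<omega>))"
    unfolding expand by (intro Bochner_Integration.integrable_sum indep_var_integrable[OF ind input_products_integrable int])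
  show "expectation (\<lambda>\<omega>. (x k \<omega> \<bullet> f \<omega>) * (x k \<omega> \<bullet> g \<omega>)) =
      (\<Sum>a\<in>UNIV. \<Sum>b\<in>UNIV. input_moment k a b * expectation (\<lambda>\<omega>. f \<omega> $ a * g \<omega> $ b))"
    unfolding expand input_moment_def
    by (simp add: indep_var_integrable[OF ind input_products_integrable int]
        indep_var_lebesgue_integral[OF ind input_products_integrable int])
qed

lemma sq_integrable_weight: "sq_integrable M w"
proof -
  have "sq_integrable M (\<lambda>\<omega>. axis i 1 \<bullet> w \<omega>)" for i
    using w_gaussian by (intro gaussian_rv_sq_integrable) (simp add: gaussian_vec_def)
  then show ?thesis
    by (simp add: sq_integrable_vec_iff[of M w] inner_axis')
qed

section \<open>Updates with second moments and the cost as a quadratic form\<close>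

definition regular_updates :: "nat \<Rightarrow> (nat \<Rightarrow> 'a \<Rightarrow> real ^ 'd) \<Rightarrow> bool" where
  "regular_updates N u \<longleftrightarrow> (\<forall>k<N. u k \<in> borel_measurable (obs_algebra k) \<and> sq_integrable M (u k))"

lemma regular_updatesD:
  assumes "regular_updates N u" "k < N"
  shows "u k \<in> borel_measurable (obs_algebra k)" "sq_integrable M (u k)"
  using assms by (auto simp: regular_updates_def)

lemma regular_imp_admissible: "regular_updates N u \<Longrightarrow> admissible_updates M w x \<epsilon> N u"
  by (simp add: regular_updates_def admissible_updates_iff)

text \<open>The estimate at time \<open>k\<close> uses observations up to \<open>k - 1\<close> only.
  The last hypothesis expresses \<open>k \<le> l + 1\<close>, so that \<open>l\<close> may be the
  predecessor of \<open>k\<close>.\<close>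

lemma estimate_obs_measurable:
  assumes "regular_updates N u" "k \<le> N" "\<And>i. i < k \<Longrightarrow> i \<le> l"
  shows "estimate u k \<in> borel_measurable (obs_algebra l)"
proof (rule estimate_measurable)
  fix i assume "i < k"
  then show "u i \<in> borel_measurable (obs_algebra l)"
    using assms by (intro borel_measurable_obs_mono[OF regular_updatesD(1)[OF assms(1)]]) simp_all
qed

lemma
  assumes u: "regular_updates N u" "k \<le> N"
  shows sq_integrable_regular_estimate: "sq_integrable M (estimate u k)"
    and sq_integrable_error: "sq_integrable M (est_error w u k)"
    and error_past_measurable: "est_error w u k \<in> borel_measurable (past_algebra k)"
proof -
  show *: "sq_integrable M (estimate u k)"
    using u by (intro sq_integrable_estimate regular_updatesD(2)[OF u(1)]) simp
  show "sq_integrable M (est_error w u k)"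
    unfolding est_error_def[abs_def] by (rule sq_integrable_diff[OF * sq_integrable_weight])
  have "u i \<in> borel_measurable (past_algebra k)" if "i < k" for i
    using u that by (intro borel_measurable_obs_past[OF regular_updatesD(1)[OF u(1)]]) simp_all
  then show "est_error w u k \<in> borel_measurable (past_algebra k)"
    unfolding est_error_def[abs_def]
    by (intro borel_measurable_diff estimate_measurable measurable_past_sources(1))
qed

text \<open>The cost integrand polarized: a pair of errors and updates \<open>(e, u)\<close> is
  tested against a direction \<open>(q, v)\<close>. The diagonal is the cost and the mixed value is
  half the first variation.\<close>

definition cost_form :: "real \<Rightarrow> nat \<Rightarrow> (nat \<Rightarrow> 'a \<Rightarrow> real ^ 'd) \<Rightarrow> (nat \<Rightarrow> 'a \<Rightarrow> real ^ 'd) \<Rightarrow>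
    (nat \<Rightarrow> 'a \<Rightarrow> real ^ 'd) \<Rightarrow> (nat \<Rightarrow> 'a \<Rightarrow> real ^ 'd) \<Rightarrow> 'a \<Rightarrow> real" where
  "cost_form \<gamma> N e u q v \<omega> =
     (\<Sum>j<N. (x j \<omega> \<bullet> e j \<omega>) * (x j \<omega> \<bullet> q j \<omega>) + \<gamma> * (u j \<omega> \<bullet> v j \<omega>))
     + (x N \<omega> \<bullet> e N \<omega>) * (x N \<omega> \<bullet> q N \<omega>)"

lemma oll_cost_cost_form:
  "oll_cost M w x \<gamma> N u = (\<integral>\<^sup>+\<omega>. ennreal (cost_form \<gamma> N (est_error w u) u (est_error w u) u \<omega>) \<partial>M)"
  by (simp add: oll_cost_def cost_form_def inner_outer power2_eq_square)

lemma cost_form_diff_scale: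
  "cost_form \<gamma> N (\<lambda>j \<omega>. e j \<omega> - t *\<^sub>R q j \<omega>) (\<lambda>j \<omega>. u j \<omega> - t *\<^sub>R v j \<omega>)
      (\<lambda>j \<omega>. e j \<omega> - t *\<^sub>R q j \<omega>) (\<lambda>j \<omega>. u j \<omega> - t *\<^sub>R v j \<omega>) \<omega>
    = cost_form \<gamma> N e u e u \<omega> - 2 * t * cost_form \<gamma> N e u q v \<omega> + t\<^sup>2 * cost_form \<gamma> N q v q v \<omega>"
proof -
  have 1: "(a \<bullet> (b - t *\<^sub>R c)) * (a \<bullet> (b - t *\<^sub>R c)) =
      (a \<bullet> b) * (a \<bullet> b) - 2 * t * ((a \<bullet> b) * (a \<bullet> c)) + t\<^sup>2 * ((a \<bullet> c) * (a \<bullet> c))" for a b c :: "real ^ 'd"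
    by (simp add: inner_diff_right power2_eq_square algebra_simps)
  have 2: "(b - t *\<^sub>R c) \<bullet> (b - t *\<^sub>R c) = b \<bullet> b - 2 * t * (b \<bullet> c) + t\<^sup>2 * (c \<bullet> c)" for b c :: "real ^ 'd"
    by (simp add: inner_diff_right inner_diff_left power2_eq_square algebra_simps inner_commute)
  show ?thesis
    unfolding cost_form_def 1 2
    by (simp add: sum.distrib sum_subtractf sum_distrib_left algebra_simps)
qed

lemma cost_form_nonneg: "\<gamma> \<ge> 0 \<Longrightarrow> cost_form \<gamma> N e u e u \<omega> \<ge> 0"
  by (auto simp: cost_form_def intro!: add_nonneg_nonneg sum_nonneg)

lemma
  assumes "\<And>j. j \<le> N \<Longrightarrow> sq_integrable M (e j)" "\<And>j. j \<le> N \<Longrightarrow> e j \<in> borel_measurable (past_algebra j)"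
    and "\<And>j. j \<le> N \<Longrightarrow> sq_integrable M (q j)" "\<And>j. j \<le> N \<Longrightarrow> q j \<in> borel_measurable (past_algebra j)"
    and "\<And>j. j < N \<Longrightarrow> sq_integrable M (u j)" "\<And>j. j < N \<Longrightarrow> sq_integrable M (v j)"
  shows integrable_cost_form: "integrable M (cost_form \<gamma> N e u q v)"
    and expectation_cost_form: "expectation (cost_form \<gamma> N e u q v) =
      (\<Sum>j<N. expectation (\<lambda>\<omega>. (x j \<omega> \<bullet> e j \<omega>) * (x j \<omega> \<bullet> q j \<omega>)) + \<gamma> * expectation (\<lambda>\<omega>. u j \<omega> \<bullet> v j \<omega>))
      + expectation (\<lambda>\<omega>. (x N \<omega> \<bullet> e N \<omega>) * (x N \<omega> \<bullet> q N \<omega>))"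
proof -
  have 1: "integrable M (\<lambda>\<omega>. (x j \<omega> \<bullet> e j \<omega>) * (x j \<omega> \<bullet> q j \<omega>))" if "j \<le> N" for j
    by (rule integrable_input_inner_product) (use assms that in auto)
  have 2: "integrable M (\<lambda>\<omega>. \<gamma> * (u j \<omega> \<bullet> v j \<omega>))" if "j < N" for j
    by (intro integrable_mult_right sq_integrable_inner) (use assms that in auto)
  have 3: "integrable M (\<lambda>\<omega>. (x j \<omega> \<bullet> e j \<omega>) * (x j \<omega> \<bullet> q j \<omega>) + \<gamma> * (u j \<omega> \<bullet> v j \<omega>))"
    if "j < N" for j
    by (rule Bochner_Integration.integrable_add[OF 1 2]) (use that in simp_all)
  have 4: "expectation (\<lambda>\<omega>. (x j \<omega> \<bullet> e j \<omega>) * (x j \<omega> \<bullet> q j \<omega>) + \<gamma> * (u j \<omega> \<bullet> v j \<omega>)) =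
      expectation (\<lambda>\<omega>. (x j \<omega> \<bullet> e j \<omega>) * (x j \<omega> \<bullet> q j \<omega>)) + \<gamma> * expectation (\<lambda>\<omega>. u j \<omega> \<bullet> v j \<omega>)"
    if "j < N" for j
    using Bochner_Integration.integral_add[OF 1 2[OF that]] that by simp
  have 5: "integrable M (\<lambda>\<omega>. \<Sum>j<N. (x j \<omega> \<bullet> e j \<omega>) * (x j \<omega> \<bullet> q j \<omega>) + \<gamma> * (u j \<omega> \<bullet> v j \<omega>))"
    by (intro Bochner_Integration.integrable_sum 3) simp
  show "integrable M (cost_form \<gamma> N e u q v)"
    unfolding cost_form_def[abs_def] by (rule Bochner_Integration.integrable_add[OF 5 1[OF order_refl]])
  have "expectation (cost_form \<gamma> N e u q v) =
      expectation (\<lambda>\<omega>. \<Sum>j<N. (x j \<omega> \<bullet> e j \<omega>) * (x j \<omega> \<bullet> q j \<omega>) + \<gamma> * (u j \<omega> \<bullet> v j \<omega>))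
      + expectation (\<lambda>\<omega>. (x N \<omega> \<bullet> e N \<omega>) * (x N \<omega> \<bullet> q N \<omega>))"
    unfolding cost_form_def[abs_def] by (rule Bochner_Integration.integral_add[OF 5 1[OF order_refl]])
  also have "expectation (\<lambda>\<omega>. \<Sum>j<N. (x j \<omega> \<bullet> e j \<omega>) * (x j \<omega> \<bullet> q j \<omega>) + \<gamma> * (u j \<omega> \<bullet> v j \<omega>)) =
      (\<Sum>j<N. expectation (\<lambda>\<omega>. (x j \<omega> \<bullet> e j \<omega>) * (x j \<omega> \<bullet> q j \<omega>) + \<gamma> * (u j \<omega> \<bullet> v j \<omega>)))"
    by (rule Bochner_Integration.integral_sum) (simp add: 3)
  also have "\<dots> = (\<Sum>j<N. expectation (\<lambda>\<omega>. (x j \<omega> \<bullet> e j \<omega>) * (x j \<omega> \<bullet> q j \<omega>)) + \<gamma> * expectation (\<lambda>\<omega>. u j \<omega> \<bullet> v j \<omega>))"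
    by (rule sum.cong) (simp_all add: 4)
  finally show "expectation (cost_form \<gamma> N e u q v) =
      (\<Sum>j<N. expectation (\<lambda>\<omega>. (x j \<omega> \<bullet> e j \<omega>) * (x j \<omega> \<bullet> q j \<omega>)) + \<gamma> * expectation (\<lambda>\<omega>. u j \<omega> \<bullet> v j \<omega>))
      + expectation (\<lambda>\<omega>. (x N \<omega> \<bullet> e N \<omega>) * (x N \<omega> \<bullet> q N \<omega>))" .
qed

lemma oll_cost_regular:
  assumes "regular_updates N u" "\<gamma> \<ge> 0"
  shows "oll_cost M w x \<gamma> N u =
      ennreal (expectation (cost_form \<gamma> N (est_error w u) u (est_error w u) u))"
proof -
  have *: "integrable M (cost_form \<gamma> N (est_error w u) u (est_error w u) u)"
    by (rule integrable_cost_form)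
      (use assms in \<open>auto intro: sq_integrable_error error_past_measurable regular_updatesD(2)\<close>)
  show ?thesis
    unfolding oll_cost_cost_form
    by (rule nn_integral_eq_integral[OF *]) (simp add: cost_form_nonneg assms(2))
qed

section \<open>First-order condition for the optimal updates\<close>

text \<open>The zero updates are admissible with finite cost, because their error is always
  \<open>- w\<close>. The optimal cost is therefore finite, and since \<gamma> is positive it
  dominates a positive multiple of each E |u_k|^2.\<close>

lemma optimal_imp_regular:
  assumes opt: "oll_optimal M w x \<epsilon> \<gamma> N u" and \<gamma>: "\<gamma> > 0"
  shows "regular_updates N u"
proof -
  have zero: "regular_updates N (\<lambda>_ _. 0)"
    by (simp add: regular_updates_def)
  have adm: "\<forall>k<N. u k \<in> borel_measurable (obs_algebra k)"
    using opt by (simp add: oll_optimal_def admissible_updates_iff)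
  have "oll_cost M w x \<gamma> N u \<le> oll_cost M w x \<gamma> N (\<lambda>_ _. 0)"
    using opt regular_imp_admissible[OF zero] by (simp add: oll_optimal_def)
  also have "\<dots> < \<infinity>"
    using \<gamma> by (simp add: oll_cost_regular[OF zero])
  finally have fin: "oll_cost M w x \<gamma> N u < \<infinity>" .
  have "sq_integrable M (u k)" if k: "k < N" for k
  proof -
    have uk: "u k \<in> borel_measurable M"
      using adm k by (intro borel_measurable_obs_M) blast
    have meas: "(\<lambda>\<omega>. \<gamma> * (u k \<omega> \<bullet> u k \<omega>)) \<in> borel_measurable M"
      by (intro borel_measurable_times borel_measurable_const borel_measurable_inner uk)
    have "\<gamma> * (u k \<omega> \<bullet> u k \<omega>) \<le> cost_form \<gamma> N (est_error w u) u (est_error w u) u \<omega>" for \<omega>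
    proof -
      have "\<gamma> * (u k \<omega> \<bullet> u k \<omega>) \<le> (x k \<omega> \<bullet> est_error w u k \<omega>) * (x k \<omega> \<bullet> est_error w u k \<omega>) + \<gamma> * (u k \<omega> \<bullet> u k \<omega>)"
        by simp
      also have "\<dots> \<le> (\<Sum>j<N. (x j \<omega> \<bullet> est_error w u j \<omega>) * (x j \<omega> \<bullet> est_error w u j \<omega>) + \<gamma> * (u j \<omega> \<bullet> u j \<omega>))"
        by (rule member_le_sum[where f = "\<lambda>j. (x j \<omega> \<bullet> est_error w u j \<omega>) * (x j \<omega> \<bullet> est_error w u j \<omega>) + \<gamma> * (u j \<omega> \<bullet> u j \<omega>)"])
          (use k \<gamma> in \<open>auto intro!: add_nonneg_nonneg\<close>)
      finally show ?thesis
        unfolding cost_form_def using zero_le_square[of "x N \<omega> \<bullet> est_error w u N \<omega>"] by linarith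
    qed
    then have "(\<integral>\<^sup>+\<omega>. ennreal (\<gamma> * (u k \<omega> \<bullet> u k \<omega>)) \<partial>M) \<le> oll_cost M w x \<gamma> N u"
      unfolding oll_cost_cost_form by (intro nn_integral_mono ennreal_leI)
    then have "integrable M (\<lambda>\<omega>. \<gamma> * (u k \<omega> \<bullet> u k \<omega>))"
      using fin \<gamma> by (intro integrableI_nonneg[OF meas]) (auto intro: order_le_less_trans)
    then show ?thesis
      using uk \<gamma> by (simp add: sq_integrable_def)
  qed
  then show ?thesis
    using adm by (simp add: regular_updates_def)
qed

text \<open>
  First-order optimality in the direction that, from time \<open>k\<close> on, scales the conditional
  means of the errors given the observations up to time \<open>k\<close>: all terms of the first variation
  other than the one with the update at time \<open>k\<close> are then expectations of squares.
\<close>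

lemma optimal_update_inner_error:
  assumes opt: "oll_optimal M w x \<epsilon> \<gamma> N u" and \<gamma>: "\<gamma> > 0" and k: "k < N"
  shows "expectation (\<lambda>\<omega>. u k \<omega> \<bullet> est_error w u (Suc k) \<omega>) \<le> 0"
proof -
  have reg: "regular_updates N u" by (rule optimal_imp_regular[OF opt \<gamma>])
  define e where "e = est_error w u"
  \<comment> \<open>An update at time \<open>k\<close> first changes the estimate at
    \<open>Suc k\<close>, hence the zeros up to \<open>k\<close>. Conditioning on the same
    \<open>obs_algebra k\<close> for every later \<open>j\<close> keeps the direction
    admissible.\<close>
  define q where "q j = (if j \<le> k then (\<lambda>_. 0) else vec_cond_exp M (obs_algebra k) (e j))" for j
  \<comment> \<open>As \<open>q 0\<close> is 0 and \<open>v\<close> consists of the increments of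
    \<open>q\<close>, subtracting \<open>t\<close> times \<open>v\<close> from the updates subtracts
    exactly \<open>t\<close> times \<open>q\<close> from all estimates and errors.\<close>
  define v where "v j = (\<lambda>\<omega>. q (Suc j) \<omega> - q j \<omega>)" for j
  have e_sq: "sq_integrable M (e j)" and e_past: "e j \<in> borel_measurable (past_algebra j)" if "j \<le> N" for j
    unfolding e_def by (rule sq_integrable_error[OF reg that], rule error_past_measurable[OF reg that])
  have q_sq: "sq_integrable M (q j)" if "j \<le> N" for j
    unfolding q_def using sq_integrable_vec_cond_exp[OF subalgebra_obs e_sq[OF that]] by simp
  have q_obs: "q j \<in> borel_measurable (obs_algebra k)" for j
    unfolding q_def using vec_cond_exp_measurable[where F = "obs_algebra k"] by (cases "j \<le> k") simp_all
  have q_past: "q j \<in> borel_measurable (past_algebra j)" for j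
  proof (cases "j \<le> k")
    case False
    then show ?thesis by (intro borel_measurable_obs_past[OF q_obs]) simp
  qed (simp add: q_def)
  have v_sq: "sq_integrable M (v j)" if "j < N" for j
    unfolding v_def using that by (intro sq_integrable_diff q_sq) simp_all
  have v_obs_k: "v j \<in> borel_measurable (obs_algebra k)" for j
    unfolding v_def by (intro borel_measurable_diff q_obs)
  have v_obs: "v j \<in> borel_measurable (obs_algebra j)" for j
  proof (cases "j < k")
    case True
    then have "v j = (\<lambda>_. 0)" by (simp add: v_def q_def)
    then show ?thesis by simp
  next
    case False
    then show ?thesis by (intro borel_measurable_obs_mono[OF v_obs_k]) simp
  qed
  have u_sq: "sq_integrable M (u j)" if "j < N" for j
    by (rule regular_updatesD(2)[OF reg that])

  have variation: "2 * t * expectation (cost_form \<gamma> N e u q v) \<le> t\<^sup>2 * expectation (cost_form \<gamma> N q v q v)"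
    for t
  proof -
    define u' where "u' = (\<lambda>j \<omega>. u j \<omega> - t *\<^sub>R v j \<omega>)"
    have est: "estimate u' j \<omega> = estimate u j \<omega> - t *\<^sub>R q j \<omega>" for j \<omega>
    proof (induction j)
      case 0
      show ?case by (simp add: q_def)
    next
      case (Suc j)
      then show ?case by (simp add: u'_def v_def algebra_simps)
    qed
    have err: "est_error w u' = (\<lambda>j \<omega>. e j \<omega> - t *\<^sub>R q j \<omega>)"
      by (intro ext) (simp add: est_error_def est e_def)
    have "admissible_updates M w x \<epsilon> N u'"
      unfolding admissible_updates_iff u'_def
    proof (intro allI impI borel_measurable_diff borel_measurable_scaleR borel_measurable_const v_obs)
      fix j assume "j < N"
      then show "u j \<in> borel_measurable (obs_algebra j)" by (rule regular_updatesD(1)[OF reg])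
    qed
    then have le: "oll_cost M w x \<gamma> N u \<le> oll_cost M w x \<gamma> N u'"
      using opt by (simp add: oll_optimal_def)
    have ee: "integrable M (cost_form \<gamma> N e u e u)" and eq: "integrable M (cost_form \<gamma> N e u q v)"
      and qq: "integrable M (cost_form \<gamma> N q v q v)"
      by (rule integrable_cost_form; (intro e_sq e_past q_sq q_past u_sq v_sq)?; assumption)+
    have form: "cost_form \<gamma> N (est_error w u') u' (est_error w u') u' \<omega> =
        cost_form \<gamma> N e u e u \<omega> - 2 * t * cost_form \<gamma> N e u q v \<omega> + t\<^sup>2 * cost_form \<gamma> N q v q v \<omega>" for \<omega>
      unfolding err by (simp only: u'_def cost_form_diff_scale)
    have nonneg: "0 \<le> cost_form \<gamma> N e u e u \<omega> - 2 * t * cost_form \<gamma> N e u q v \<omega> + t\<^sup>2 * cost_form \<gamma> N q v q v \<omega>" for \<omega>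
      using cost_form_nonneg[of \<gamma> N "est_error w u'" u' \<omega>] \<gamma> by (simp add: form)
    have "oll_cost M w x \<gamma> N u' = ennreal (expectation (\<lambda>\<omega>.
        cost_form \<gamma> N e u e u \<omega> - 2 * t * cost_form \<gamma> N e u q v \<omega> + t\<^sup>2 * cost_form \<gamma> N q v q v \<omega>))"
      unfolding oll_cost_cost_form form using ee eq qq
      by (intro nn_integral_eq_integral AE_I2 nonneg) simp
    also have "\<dots> = ennreal (expectation (cost_form \<gamma> N e u e u)
        - 2 * t * expectation (cost_form \<gamma> N e u q v) + t\<^sup>2 * expectation (cost_form \<gamma> N q v q v))"
      using ee eq qq by simp
    finally have cost': "oll_cost M w x \<gamma> N u' = ennreal (expectation (cost_form \<gamma> N e u e u)
        - 2 * t * expectation (cost_form \<gamma> N e u q v) + t\<^sup>2 * expectation (cost_form \<gamma> N q v q v))" .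
    have "oll_cost M w x \<gamma> N u = ennreal (expectation (cost_form \<gamma> N e u e u))"
      unfolding e_def using oll_cost_regular[OF reg] \<gamma> by simp
    \<comment> \<open>\<open>ennreal\<close> truncates negative numbers to 0, so the comparison of
      costs passes to the reals only once the right-hand side is known to be nonnegative.\<close>
    moreover have "0 \<le> expectation (cost_form \<gamma> N e u e u)
        - 2 * t * expectation (cost_form \<gamma> N e u q v) + t\<^sup>2 * expectation (cost_form \<gamma> N q v q v)"
    proof -
      have "0 \<le> expectation (\<lambda>\<omega>.
          cost_form \<gamma> N e u e u \<omega> - 2 * t * cost_form \<gamma> N e u q v \<omega> + t\<^sup>2 * cost_form \<gamma> N q v q v \<omega>)"
        by (intro Bochner_Integration.integral_nonneg nonneg)
      then show ?thesis
        using ee eq qq by simp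
    qed
    ultimately show ?thesis
      using le unfolding cost' by simp
  qed
  then have nonpos: "expectation (cost_form \<gamma> N e u q v) \<le> 0"
    by (rule nonpos_if_quadratic_nonneg)

  have project: "expectation (\<lambda>\<omega>. g \<omega> \<bullet> e j \<omega>) = expectation (\<lambda>\<omega>. g \<omega> \<bullet> q j \<omega>)"
    if "k < j" "j \<le> N" "sq_integrable M g" "g \<in> borel_measurable (obs_algebra k)" for g j
    using integral_inner_vec_cond_exp[OF subalgebra_obs[of k] e_sq[OF that(2)] that(3,4)] that(1)
    by (simp add: q_def)

  \<comment> \<open>For \<open>j\<close> after \<open>k\<close>, the moments of x_j factor out. In
    each remaining E (e_a q_b) the error coordinate may be replaced by its projection, since
    \<open>q j\<close> is observed at time \<open>k\<close>; reassembling gives the expectation of a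
    square.\<close>
  have input_nonneg: "0 \<le> expectation (\<lambda>\<omega>. (x j \<omega> \<bullet> e j \<omega>) * (x j \<omega> \<bullet> q j \<omega>))" if j: "j \<le> N" for j
  proof (cases "j \<le> k")
    case True
    then show ?thesis by (simp add: q_def)
  next
    case False
    have "expectation (\<lambda>\<omega>. e j \<omega> $ a * q j \<omega> $ b) = expectation (\<lambda>\<omega>. q j \<omega> $ a * q j \<omega> $ b)" for a b
    proof -
      have "sq_integrable M (\<lambda>\<omega>. q j \<omega> $ b)" "(\<lambda>\<omega>. q j \<omega> $ b) \<in> borel_measurable (obs_algebra k)"
        using q_sq[OF j] q_obs[of j] sq_integrable_vec_iff[of M "q j"] borel_measurable_vec_iff[of "q j"]
        by blast+
      from integral_mult_vec_cond_exp[OF subalgebra_obs e_sq[OF j] this, of a] show ?thesis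
        using False by (simp add: q_def mult.commute)
    qed
    then have "expectation (\<lambda>\<omega>. (x j \<omega> \<bullet> e j \<omega>) * (x j \<omega> \<bullet> q j \<omega>)) =
        expectation (\<lambda>\<omega>. (x j \<omega> \<bullet> q j \<omega>) * (x j \<omega> \<bullet> q j \<omega>))"
      by (simp add: expectation_input_inner_product e_sq e_past q_sq q_past j)
    then show ?thesis by simp
  qed

  \<comment> \<open>For \<open>j\<close> after \<open>k\<close>, the update is the increment of the
    error and \<open>v j\<close> is the increment of its projections, so the term equals E |v_j|^2.
    This fails at \<open>j = k\<close>, where \<open>q k\<close> is 0 instead of the projection of
    \<open>e k\<close>.\<close>
  have control_nonneg: "0 \<le> expectation (\<lambda>\<omega>. u j \<omega> \<bullet> v j \<omega>)" if j: "j < N" "j \<noteq> k" for j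
  proof (cases "j < k")
    case True
    then show ?thesis by (simp add: v_def q_def)
  next
    case False
    then have kj: "k < j" using j by simp
    have int: "integrable M (\<lambda>\<omega>. v j \<omega> \<bullet> e i \<omega>)" "integrable M (\<lambda>\<omega>. v j \<omega> \<bullet> q i \<omega>)" if "i \<le> N" for i
      by (rule sq_integrable_inner[OF v_sq[OF j(1)] e_sq[OF that]],
          rule sq_integrable_inner[OF v_sq[OF j(1)] q_sq[OF that]])
    have "expectation (\<lambda>\<omega>. u j \<omega> \<bullet> v j \<omega>) = expectation (\<lambda>\<omega>. v j \<omega> \<bullet> e (Suc j) \<omega> - v j \<omega> \<bullet> e j \<omega>)"
      by (simp add: e_def est_error_def inner_commute flip: inner_diff_right)
    also have "\<dots> = expectation (\<lambda>\<omega>. v j \<omega> \<bullet> e (Suc j) \<omega>) - expectation (\<lambda>\<omega>. v j \<omega> \<bullet> e j \<omega>)"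
      using j by (intro Bochner_Integration.integral_diff int) simp_all
    also have "\<dots> = expectation (\<lambda>\<omega>. v j \<omega> \<bullet> q (Suc j) \<omega>) - expectation (\<lambda>\<omega>. v j \<omega> \<bullet> q j \<omega>)"
      using project[OF _ _ v_sq[OF j(1)] v_obs_k] kj j by simp
    also have "\<dots> = expectation (\<lambda>\<omega>. v j \<omega> \<bullet> q (Suc j) \<omega> - v j \<omega> \<bullet> q j \<omega>)"
      using j by (intro Bochner_Integration.integral_diff[symmetric] int) simp_all
    also have "\<dots> = expectation (\<lambda>\<omega>. v j \<omega> \<bullet> v j \<omega>)"
      by (simp add: v_def inner_diff_right)
    finally show ?thesis by simp
  qed

  \<comment> \<open>At time \<open>k\<close> the direction is \<open>q (Suc k)\<close> itself, and
    since \<open>u k\<close> is observed at time \<open>k\<close> the projection can be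
    undone.\<close>
  have "expectation (\<lambda>\<omega>. u k \<omega> \<bullet> v k \<omega>) = expectation (\<lambda>\<omega>. u k \<omega> \<bullet> q (Suc k) \<omega>)"
    by (simp add: v_def q_def)
  also have "\<dots> = expectation (\<lambda>\<omega>. u k \<omega> \<bullet> e (Suc k) \<omega>)"
    using k by (intro project[symmetric] u_sq regular_updatesD(1)[OF reg]) simp_all
  finally have uk: "expectation (\<lambda>\<omega>. u k \<omega> \<bullet> e (Suc k) \<omega>) = expectation (\<lambda>\<omega>. u k \<omega> \<bullet> v k \<omega>)" ..

  have "\<gamma> * expectation (\<lambda>\<omega>. u k \<omega> \<bullet> v k \<omega>) \<le>
      expectation (\<lambda>\<omega>. (x k \<omega> \<bullet> e k \<omega>) * (x k \<omega> \<bullet> q k \<omega>)) + \<gamma> * expectation (\<lambda>\<omega>. u k \<omega> \<bullet> v k \<omega>)"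
    using input_nonneg[of k] k by simp
  also have "\<dots> \<le> (\<Sum>j<N. expectation (\<lambda>\<omega>. (x j \<omega> \<bullet> e j \<omega>) * (x j \<omega> \<bullet> q j \<omega>)) + \<gamma> * expectation (\<lambda>\<omega>. u j \<omega> \<bullet> v j \<omega>))"
    by (rule member_le_sum[where f = "\<lambda>j. expectation (\<lambda>\<omega>. (x j \<omega> \<bullet> e j \<omega>) * (x j \<omega> \<bullet> q j \<omega>)) + \<gamma> * expectation (\<lambda>\<omega>. u j \<omega> \<bullet> v j \<omega>)"])
      (use k \<gamma> in \<open>auto intro!: add_nonneg_nonneg input_nonneg mult_nonneg_nonneg control_nonneg\<close>)
  also have "\<dots> \<le> expectation (cost_form \<gamma> N e u q v)"
    using input_nonneg[of N]
    by (subst expectation_cost_form) (simp_all add: e_sq e_past q_sq q_past u_sq v_sq)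
  also note nonpos
  finally show ?thesis
    using \<gamma> uk by (simp add: e_def mult_le_0_iff)
qed

section \<open>Orthogonality of the Kalman errors\<close>

text \<open>The defining conditional mean is taken given output errors and updates, whereas
  orthogonality is wanted for functions of the observations. The latter generate a subalgebra of the
  former's algebra, so every such function is a legitimate multiplier in the projection
  identity.\<close>

lemma
  fixes f :: "'a \<Rightarrow> real ^ 'd"
  assumes kal: "kalman_updates M w x \<epsilon> N u"
  shows kalman_imp_regular: "regular_updates N u"
    and kalman_error_orthogonal: "k < N \<Longrightarrow> sq_integrable M f \<Longrightarrow> f \<in> borel_measurable (obs_algebra k) \<Longrightarrow>
      expectation (\<lambda>\<omega>. f \<omega> \<bullet> est_error w u (Suc k) \<omega>) = 0"
proof -
  define F where "F k = vimage_algebra (space M) (info_vec_tilde w x \<epsilon> u k) (info_space k)" for k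
  have adm: "u k \<in> borel_measurable (obs_algebra k)" if "k < N" for k
    using kal that by (simp add: kalman_updates_def admissible_updates_iff)
  have u_eq: "AE \<omega> in M. u k \<omega> = - vec_cond_exp M (F k) (est_error w u k) \<omega>" if "k < N" for k
    using kal that by (simp add: kalman_updates_def F_def)
  have info_M: "info_vec_tilde w x \<epsilon> u k \<in> measurable M (info_space k)" if k: "k < N" for k
  proof -
    have u: "u i \<in> borel_measurable M" if "i < k" for i
      using that k by (intro borel_measurable_obs_M[OF adm]) simp
    have "output_error w x \<epsilon> u j \<in> borel_measurable M" if "j \<le> k" for j
      unfolding output_error_def[abs_def]
      using u that by (intro borel_measurable_diff borel_measurable_inner estimate_measurable x_rv
          borel_measurable_obs_M[OF obs_algebra_measurable(2)[OF order_refl]]) simp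
    then show ?thesis
      unfolding info_vec_tilde_def[abs_def] info_space_def
      by (intro measurable_Pair measurable_restrict borel_measurable_Pair x_rv u; simp only: atMost_iff lessThan_iff)
  qed
  have F_sub: "subalgebra M (F k)" if "k < N" for k
    using sets_image_in_sets[OF refl info_M[OF that]] by (simp add: subalgebra_def F_def)
  have obs_F: "sets (obs_algebra k) \<subseteq> sets (F k)" if k: "k < N" for k
  proof (rule obs_algebra_subset)
    have info_F: "info_vec_tilde w x \<epsilon> u k \<in> measurable (F k) (info_space k)"
      unfolding F_def using measurable_space[OF info_M[OF k]]
      by (intro measurable_vimage_algebra1) auto
    have "(\<lambda>\<omega>. snd (info_vec_tilde w x \<epsilon> u k \<omega>)) \<in> measurable (F k) (\<Pi>\<^sub>M j\<in>{..<k}. borel)"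
      using info_F unfolding info_space_def by (rule measurable_compose[OF _ measurable_snd])
    from measurable_compose[OF this measurable_component_singleton]
    have u: "u i \<in> borel_measurable (F k)" if "i < k" for i
      using that by (force simp: info_vec_tilde_def)
    have "(\<lambda>\<omega>. fst (info_vec_tilde w x \<epsilon> u k \<omega>)) \<in> measurable (F k) (\<Pi>\<^sub>M j\<in>{..k}. borel)"
      using info_F unfolding info_space_def by (rule measurable_compose[OF _ measurable_fst])
    from measurable_compose[OF this measurable_component_singleton]
    have *: "(\<lambda>\<omega>. (x j \<omega>, output_error w x \<epsilon> u j \<omega>)) \<in> measurable (F k) (borel \<Otimes>\<^sub>M borel)" if "j \<le> k" for j
      using that by (force simp: info_vec_tilde_def borel_prod)
    show xj: "x j \<in> borel_measurable (F k)" if "j \<le> k" for j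
      using measurable_compose[OF *[OF that] measurable_fst] by simp
    show "observation w x \<epsilon> j \<in> borel_measurable (F k)" if j: "j \<le> k" for j
    proof -
      have "output_error w x \<epsilon> u j \<in> borel_measurable (F k)"
        using measurable_compose[OF *[OF j] measurable_snd] by simp
      \<comment> \<open>The output is recovered from the output error by adding the prediction back;
        the estimate needed for it is the sum of the recorded updates before
        \<open>j\<close>.\<close>
      then have "(\<lambda>\<omega>. estimate u j \<omega> \<bullet> x j \<omega> - output_error w x \<epsilon> u j \<omega>) \<in> borel_measurable (F k)"
        using j by (intro borel_measurable_diff borel_measurable_inner estimate_measurable u xj) simp_all
      moreover have "(\<lambda>\<omega>. estimate u j \<omega> \<bullet> x j \<omega> - output_error w x \<epsilon> u j \<omega>) = observation w x \<epsilon> j"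
        by (simp add: output_error_def fun_eq_iff)
      ultimately show ?thesis by simp
    qed
  qed (simp add: F_def)
  \<comment> \<open>Strong induction: the error being projected at time \<open>k\<close> is square
    integrable because the earlier updates are. Measurability of \<open>u k\<close> comes from
    admissibility, since the projection determines it only almost everywhere.\<close>
  have sq: "sq_integrable M (u k)" if "k < N" for k
    using that
  proof (induction k rule: less_induct)
    case (less k)
    have "sq_integrable M (est_error w u k)"
      unfolding est_error_def[abs_def] using less
      by (intro sq_integrable_diff sq_integrable_estimate sq_integrable_weight) simp
    then show ?case
      by (intro sq_integrable_cong_AE[OF sq_integrable_minus[OF sq_integrable_vec_cond_exp[OF F_sub]]
            _ u_eq] borel_measurable_obs_M[OF adm] less.prems)
  qed
  show reg: "regular_updates N u"
    using adm sq by (simp add: regular_updates_def)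
  assume k: "k < N" and f: "sq_integrable M f" "f \<in> borel_measurable (obs_algebra k)"
  have e: "sq_integrable M (est_error w u k)"
    using k by (intro sq_integrable_error[OF reg]) simp
  have fF: "f \<in> borel_measurable (F k)"
    by (rule measurable_sets_subset[OF f(2) _ obs_F[OF k]]) (simp add: F_def)
  have "expectation (\<lambda>\<omega>. f \<omega> \<bullet> est_error w u (Suc k) \<omega>) =
      expectation (\<lambda>\<omega>. f \<omega> \<bullet> est_error w u k \<omega> + f \<omega> \<bullet> u k \<omega>)"
    by (simp add: est_error_def algebra_simps inner_add_right inner_diff_right)
  also have "\<dots> = expectation (\<lambda>\<omega>. f \<omega> \<bullet> est_error w u k \<omega>) + expectation (\<lambda>\<omega>. f \<omega> \<bullet> u k \<omega>)"
    by (intro Bochner_Integration.integral_add sq_integrable_inner f e sq k)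
  also have "expectation (\<lambda>\<omega>. f \<omega> \<bullet> u k \<omega>) =
      expectation (\<lambda>\<omega>. - (f \<omega> \<bullet> vec_cond_exp M (F k) (est_error w u k) \<omega>))"
  proof (rule integral_cong_AE)
    show "AE \<omega> in M. f \<omega> \<bullet> u k \<omega> = - (f \<omega> \<bullet> vec_cond_exp M (F k) (est_error w u k) \<omega>)"
      using u_eq[OF k] by eventually_elim simp
  qed (intro borel_measurable_uminus borel_measurable_inner sq_integrable_measurable f sq k
      sq_integrable_vec_cond_exp F_sub e)+
  also have "\<dots> = - expectation (\<lambda>\<omega>. f \<omega> \<bullet> est_error w u k \<omega>)"
    using integral_inner_vec_cond_exp[OF F_sub[OF k] e f(1) fF] by simp
  finally show "expectation (\<lambda>\<omega>. f \<omega> \<bullet> est_error w u (Suc k) \<omega>) = 0"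
    by simp
qed

end

section \<open>Comparison of the two update energies\<close>

theorem proposition8:
  fixes M :: "'a measure"
    and w :: "'a \<Rightarrow> real ^ 'd"
    and x :: "nat \<Rightarrow> 'a \<Rightarrow> real ^ 'd"
    and \<epsilon> :: "nat \<Rightarrow> 'a \<Rightarrow> real"
    and \<Sigma>w :: "real ^ 'd ^ 'd"
    and \<sigma>2 \<gamma> :: real
    and N :: nat
    and u_opt u_kal :: "nat \<Rightarrow> 'a \<Rightarrow> real ^ 'd"
  assumes "learning_model M w x \<epsilon> \<Sigma>w \<sigma>2"
    and "\<gamma> > 0"
    and "N \<ge> 1"
    and "oll_optimal M w x \<epsilon> \<gamma> N u_opt"
    and "kalman_updates M w x \<epsilon> N u_kal"
  shows "(\<integral>\<^sup>+\<omega>. ennreal (\<Sum>k<N. u_opt k \<omega> \<bullet> u_opt k \<omega>) \<partial>M)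
       \<le> (\<integral>\<^sup>+\<omega>. ennreal (\<Sum>k<N. u_kal k \<omega> \<bullet> u_kal k \<omega>) \<partial>M)"
proof -
  interpret learning_model M w x \<epsilon> \<Sigma>w \<sigma>2 by fact
  note opt = optimal_imp_regular[OF assms(4,2)]
  note kal = kalman_imp_regular[OF assms(5)]
  define D where "D k = (\<lambda>\<omega>. estimate u_kal k \<omega> - estimate u_opt k \<omega>)" for k
  have D_sq: "sq_integrable M (D k)" if "k \<le> N" for k
    unfolding D_def using that
    by (intro sq_integrable_diff sq_integrable_regular_estimate[OF kal] sq_integrable_regular_estimate[OF opt])
  have D_error: "D k \<omega> = est_error w u_kal k \<omega> - est_error w u_opt k \<omega>" for k \<omega>
    by (simp add: D_def est_error_def)
  \<comment> \<open>At time 0 the gap \<open>D 0\<close> vanishes. At time \<open>Suc l\<close> it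
    is a function of the observations up to \<open>l\<close>, hence orthogonal to the Kalman errors
    before and after the update, whose difference is the update.\<close>
  have kal_orth: "expectation (\<lambda>\<omega>. D k \<omega> \<bullet> u_kal k \<omega>) = 0" if k: "k < N" for k
  proof (cases k)
    case 0
    then show ?thesis by (simp add: D_def)
  next
    case (Suc l)
    have D_obs: "D k \<in> borel_measurable (obs_algebra l)"
      unfolding D_def using k Suc
      by (intro borel_measurable_diff estimate_obs_measurable[OF kal] estimate_obs_measurable[OF opt]) simp_all
    have int: "integrable M (\<lambda>\<omega>. D k \<omega> \<bullet> est_error w u_kal j \<omega>)" if "j \<le> N" for j
      using k that by (intro sq_integrable_inner D_sq sq_integrable_error[OF kal]) simp_all
    have "expectation (\<lambda>\<omega>. D k \<omega> \<bullet> u_kal k \<omega>) =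
        expectation (\<lambda>\<omega>. D k \<omega> \<bullet> est_error w u_kal (Suc k) \<omega> - D k \<omega> \<bullet> est_error w u_kal k \<omega>)"
      by (simp add: est_error_def flip: inner_diff_right)
    also have "\<dots> = expectation (\<lambda>\<omega>. D k \<omega> \<bullet> est_error w u_kal (Suc k) \<omega>)
        - expectation (\<lambda>\<omega>. D k \<omega> \<bullet> est_error w u_kal k \<omega>)"
      using k by (intro Bochner_Integration.integral_diff int) simp_all
    also have "expectation (\<lambda>\<omega>. D k \<omega> \<bullet> est_error w u_kal (Suc k) \<omega>) = 0"
      using k Suc by (intro kalman_error_orthogonal[OF assms(5)] D_sq borel_measurable_obs_mono[OF D_obs]) simp_all
    also have "expectation (\<lambda>\<omega>. D k \<omega> \<bullet> est_error w u_kal k \<omega>) = 0"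
      unfolding Suc using k Suc D_obs by (intro kalman_error_orthogonal[OF assms(5)] D_sq) simp_all
    finally show ?thesis by simp
  qed
  \<comment> \<open>The gap is the Kalman error minus the optimal error. Tested against
    \<open>u_opt k\<close>, which is observed at time \<open>k\<close>, the former contributes 0 and
    the latter has the sign given by the first-order condition.\<close>
  have opt_nonneg: "expectation (\<lambda>\<omega>. D (Suc k) \<omega> \<bullet> u_opt k \<omega>) \<ge> 0" if k: "k < N" for k
  proof -
    note u = regular_updatesD[OF opt k]
    have int: "integrable M (\<lambda>\<omega>. u_opt k \<omega> \<bullet> est_error w u_kal (Suc k) \<omega>)"
        "integrable M (\<lambda>\<omega>. u_opt k \<omega> \<bullet> est_error w u_opt (Suc k) \<omega>)"
      using k by (intro sq_integrable_inner u sq_integrable_error[OF kal] sq_integrable_error[OF opt]; simp)+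
    have "expectation (\<lambda>\<omega>. D (Suc k) \<omega> \<bullet> u_opt k \<omega>) = expectation (\<lambda>\<omega>.
        u_opt k \<omega> \<bullet> est_error w u_kal (Suc k) \<omega> - u_opt k \<omega> \<bullet> est_error w u_opt (Suc k) \<omega>)"
      unfolding D_error by (simp only: inner_commute[of _ "u_opt k _"] inner_diff_right)
    also have "\<dots> = expectation (\<lambda>\<omega>. u_opt k \<omega> \<bullet> est_error w u_kal (Suc k) \<omega>)
        - expectation (\<lambda>\<omega>. u_opt k \<omega> \<bullet> est_error w u_opt (Suc k) \<omega>)"
      by (rule Bochner_Integration.integral_diff[OF int])
    finally show ?thesis
      using kalman_error_orthogonal[OF assms(5) k u(2,1)] optimal_update_inner_error[OF assms(4,2) k]
      by simp
  qed
  \<comment> \<open>The squared gap stays on the left to carry the induction; it is discarded only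
    at \<open>n = N\<close>.\<close>
  have energy: "(\<Sum>k<n. expectation (\<lambda>\<omega>. u_opt k \<omega> \<bullet> u_opt k \<omega>)) + expectation (\<lambda>\<omega>. D n \<omega> \<bullet> D n \<omega>)
      \<le> (\<Sum>k<n. expectation (\<lambda>\<omega>. u_kal k \<omega> \<bullet> u_kal k \<omega>))" if "n \<le> N" for n
    using that
  proof (induction n)
    case 0
    then show ?case by (simp add: D_def)
  next
    case (Suc n)
    then have n: "n < N" "n \<le> N" "Suc n \<le> N" by simp_all
    note uo = regular_updatesD(2)[OF opt n(1)] and uk = regular_updatesD(2)[OF kal n(1)]
    have expand: "expectation (\<lambda>\<omega>. (f \<omega> + g \<omega>) \<bullet> (f \<omega> + g \<omega>)) =
        expectation (\<lambda>\<omega>. f \<omega> \<bullet> f \<omega>) + 2 * expectation (\<lambda>\<omega>. f \<omega> \<bullet> g \<omega>) + expectation (\<lambda>\<omega>. g \<omega> \<bullet> g \<omega>)"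
      if f: "sq_integrable M f" and g: "sq_integrable M g" for f g :: "'a \<Rightarrow> real ^ 'd"
    proof -
      have "(f \<omega> + g \<omega>) \<bullet> (f \<omega> + g \<omega>) = f \<omega> \<bullet> f \<omega> + 2 * (f \<omega> \<bullet> g \<omega>) + g \<omega> \<bullet> g \<omega>" for \<omega>
        by (simp add: inner_add_left inner_add_right inner_commute)
      then show ?thesis
        using sq_integrable_inner[OF f f] sq_integrable_inner[OF f g] sq_integrable_inner[OF g g] by simp
    qed
    \<comment> \<open>Both sides are the new Kalman estimate minus the old optimal estimate.\<close>
    have "D n \<omega> + u_kal n \<omega> = D (Suc n) \<omega> + u_opt n \<omega>" for \<omega>
      by (simp add: D_def)
    then have "expectation (\<lambda>\<omega>. D n \<omega> \<bullet> D n \<omega>) + expectation (\<lambda>\<omega>. u_kal n \<omega> \<bullet> u_kal n \<omega>) =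
        expectation (\<lambda>\<omega>. D (Suc n) \<omega> \<bullet> D (Suc n) \<omega>) + 2 * expectation (\<lambda>\<omega>. D (Suc n) \<omega> \<bullet> u_opt n \<omega>)
        + expectation (\<lambda>\<omega>. u_opt n \<omega> \<bullet> u_opt n \<omega>)"
      using expand[OF D_sq[OF n(2)] uk] expand[OF D_sq[OF n(3)] uo] kal_orth[OF n(1)] by simp
    then show ?case
      using Suc.IH n opt_nonneg[OF n(1)] by simp
  qed
  have nn: "(\<integral>\<^sup>+\<omega>. ennreal (\<Sum>k<N. u k \<omega> \<bullet> u k \<omega>) \<partial>M) =
      ennreal (\<Sum>k<N. expectation (\<lambda>\<omega>. u k \<omega> \<bullet> u k \<omega>))" if "regular_updates N u" for u
  proof -
    have int: "integrable M (\<lambda>\<omega>. u k \<omega> \<bullet> u k \<omega>)" if "k \<in> {..<N}" for k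
      using that regular_updatesD(2)[OF \<open>regular_updates N u\<close>] by (intro sq_integrable_inner) simp_all
    show ?thesis
      by (subst nn_integral_eq_integral[OF Bochner_Integration.integrable_sum[OF int]])
        (simp_all add: sum_nonneg Bochner_Integration.integral_sum int)
  qed
  have "0 \<le> expectation (\<lambda>\<omega>. D N \<omega> \<bullet> D N \<omega>)" by simp
  with energy[OF order_refl] show ?thesis
    unfolding nn[OF opt] nn[OF kal] by (intro ennreal_leI) linarith
qed

end
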